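(* There exists an absolute constant $C<\infty$ such that for every integer $N\ge 1$ the space $$\mathcal{P}_N^{(3)}=\operatorname{span}\big\{\zeta_1^{j_1}\zeta_2^{j_2}\zeta_3^{N-j_1-j_2} : j_1,j_2\in\mathbb{Z},\ j_1,j_2\ge 0,\ j_1+j_2\le N\big\}$$ of complex homogeneous polynomials of degree $N$ in three complex variables has a basis which is orthonormal in $L^2(\partial B_3,\sigma)$ and each of whose elements $f$ satisfies $\sup_{\zeta\in B_3}|f(\zeta)|\le C$.
   Context: $B_3=\{\zeta\in\mathbb{C}^3: \|\zeta\|\le 1\}$ is the closed Euclidean unit ball of $\mathbb{C}^3$, $\partial B_3$ is the unit sphere, and $\sigma$ is the normalized (probability) surface measure on $\partial B_3$. The span is the complex linear span. *)

theory Defs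
  imports
    "HOL-Analysis.Analysis"
    "HOL-Probability.Probability_Measure"
    "HOL-Library.Function_Algebras"
begin

text \<open>
  The normalized surface measure on the unit sphere: push the uniform distribution on the unit
  ball forward along the radial projection \<open>sgn x = x /\<^sub>R norm x\<close>. By
  \<open>emeasure_sphere_measure\<close> below this is the cone (polar coordinate) description
  \<open>\<sigma>(A) = \<lambda>{r x | 0 < r \<le> 1, x \<in> A} / \<lambda>(B)\<close> of surface measure. The origin, where \<open>sgn 0 = 0\<close>
  is not on the sphere, is a null set.
\<close>

definition sphere_measure :: "'a::euclidean_space measure" where
  "sphere_measure =
     restrict_space (distr (uniform_measure lborel (cball 0 1)) borel sgn) (sphere 0 1)"

lemma space_sphere_measure [simp]: "space sphere_measure = sphere 0 1"
  by (simp add: sphere_measure_def space_restrict_space)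

lemma sets_sphere_measure [simp]:
  "sets sphere_measure = sets (restrict_space borel (sphere 0 1))"
  unfolding sphere_measure_def by (rule sets_restrict_space_cong) simp

lemma sgn_measurable: "sgn \<in> borel_measurable (borel :: 'a::euclidean_space measure)"
  unfolding sgn_div_norm[abs_def] by measurable

lemma emeasure_sphere_measure:
  fixes A :: "'a::euclidean_space set"
  assumes A: "A \<in> sets borel" "A \<subseteq> sphere 0 1"
  shows "emeasure sphere_measure A =
    emeasure lborel {r *\<^sub>R x | r x. 0 < r \<and> r \<le> 1 \<and> x \<in> A} / emeasure lborel (cball (0::'a) 1)"
proof -
  have eq: "cball 0 1 \<inter> sgn -` A = {r *\<^sub>R x | r x. 0 < r \<and> r \<le> 1 \<and> x \<in> A}"
  proof (intro set_eqI iffI)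
    fix y :: 'a
    assume y: "y \<in> cball 0 1 \<inter> sgn -` A"
    then have "y \<noteq> 0"
      using A(2) by auto
    then have "y = norm y *\<^sub>R sgn y" "0 < norm y"
      by (simp_all add: sgn_div_norm)
    then show "y \<in> {r *\<^sub>R x | r x. 0 < r \<and> r \<le> 1 \<and> x \<in> A}"
      using y by (intro CollectI exI[of _ "norm y"] exI[of _ "sgn y"]) auto
  next
    fix y :: 'a
    assume "y \<in> {r *\<^sub>R x | r x. 0 < r \<and> r \<le> 1 \<and> x \<in> A}"
    then obtain r x where rx: "y = r *\<^sub>R x" "0 < r" "r \<le> 1" "x \<in> A"
      by auto
    then have "norm x = 1"
      using A(2) by auto
    then show "y \<in> cball 0 1 \<inter> sgn -` A"
      using rx by (simp add: sgn_div_norm)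
  qed
  have m: "sgn \<in> measurable (uniform_measure lborel (cball (0::'a) 1)) borel"
    using sgn_measurable by (simp add: measurable_def)
  have sA: "sgn -` A \<in> sets (borel :: 'a measure)"
    using measurable_sets[OF sgn_measurable A(1)] by simp
  have "emeasure sphere_measure A =
      emeasure (distr (uniform_measure lborel (cball 0 1)) borel sgn) A"
    unfolding sphere_measure_def using A by (subst emeasure_restrict_space) auto
  also have "\<dots> = emeasure (uniform_measure lborel (cball 0 1)) (sgn -` A)"
    using A m by (subst emeasure_distr) auto
  also have "\<dots> = emeasure lborel (cball 0 1 \<inter> sgn -` A) / emeasure lborel (cball (0::'a) 1)"
    using sA by (subst emeasure_uniform_measure) auto
  finally show ?thesis
    by (simp only: eq)
qed

lemma prob_space_sphere_measure: "prob_space (sphere_measure :: 'a::euclidean_space measure)"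
proof
  let ?C = "{r *\<^sub>R x | r x. 0 < r \<and> r \<le> 1 \<and> x \<in> sphere (0::'a) 1}"
  have "?C = cball 0 1 - {0}"
  proof (intro set_eqI iffI)
    fix y :: 'a
    assume "y \<in> cball 0 1 - {0}"
    then have "y = norm y *\<^sub>R sgn y" "0 < norm y" "norm y \<le> 1" "norm (sgn y) = 1"
      by (simp_all add: sgn_div_norm)
    then show "y \<in> ?C"
      by (metis (mono_tags, lifting) mem_Collect_eq mem_sphere_0)
  qed auto
  moreover have "emeasure lborel (cball 0 1 - {0::'a}) = emeasure lborel (cball (0::'a) 1)"
    by (intro emeasure_Diff_null_set) (auto simp: null_sets_def)
  moreover have "emeasure lborel (cball (0::'a) 1) \<noteq> 0"
    using content_cball_pos[of 1 "0::'a"] by (auto simp: measure_def)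
  moreover have "emeasure lborel (cball (0::'a) 1) \<noteq> top"
    using emeasure_bounded_finite[of "cball (0::'a) 1"] by (simp add: less_top)
  ultimately show "emeasure sphere_measure (space (sphere_measure :: 'a measure)) = 1"
    by (simp add: emeasure_sphere_measure ennreal_divide_self less_top)
qed

text \<open>The complex vector space of all functions from \<open>\<complex>\<^sup>3\<close> to \<open>\<complex>\<close>.\<close>

global_interpretation cfun: vector_space "\<lambda>(c::complex) (f::complex^3 \<Rightarrow> complex) z. c * f z"
  by unfold_locales (auto simp: fun_eq_iff algebra_simps)

definition homogeneous_polys :: "nat \<Rightarrow> (complex^3 \<Rightarrow> complex) set" where
  "homogeneous_polys N =
     cfun.span {(\<lambda>z. (z $ 1) ^ j1 * (z $ 2) ^ j2 * (z $ 3) ^ (N - j1 - j2)) | j1 j2. j1 + j2 \<le> N}"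

definition sphere_inner :: "(complex^3 \<Rightarrow> complex) \<Rightarrow> (complex^3 \<Rightarrow> complex) \<Rightarrow> complex" where
  "sphere_inner f g = (LINT z|sphere_measure. f z * cnj (g z))"

definition sphere_orthonormal :: "(complex^3 \<Rightarrow> complex) set \<Rightarrow> bool" where
  "sphere_orthonormal B \<longleftrightarrow> (\<forall>f\<in>B. \<forall>g\<in>B. sphere_inner f g = (if f = g then 1 else 0))"

end

theory Submission
  imports Defs
begin

text \<open>The normalized monomials are indexed by the triangle \<open>{(a, b). a + b \<le> N}\<close>, and their
  moduli at a point of the sphere are, up to the square root of the dimension, square roots of a
  trinomial distribution. Folding the triangle into a rectangle provides a unitary matrix with
  entries of constant modulus, namely a character table, which may be multiplied by arbitrary
  unimodular phases depending on \<open>(a, b)\<close>. The elements of the resulting basis are bounded once the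
  phases show square root cancellation against the trinomial weights, twisted by any character.

  Each trinomial weight is a product of two binomial ones. For the inner sum over \<open>b\<close>, with weights
  of the binomial distribution of \<open>m\<close> trials with success probability \<open>q\<close>, Rudin--Shapiro signs give
  a bounded polynomial \<open>F\<^sub>m\<close>, and \<open>sqrt (1 - q) \<bar>F\<^sub>m\<^sub>+\<^sub>1 - F\<^sub>m\<bar>\<close> is at most of order \<open>1 / sqrt m\<close>. The
  factor \<open>sqrt (1 - q)\<close> is produced by the blend of two sign patterns in the definition of the phases;
  with it, the inner sums vary slowly enough with \<open>a\<close> for the outer sum to be bounded in the same
  way.\<close>

section \<open>The Rudin--Shapiro sequence\<close>

text \<open>The squared norm of a monomial on the sphere is 1 divided by the product of the
  dimension and its trinomial coefficient. The square root of the dimension gained by normalizing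
  cancels against the entries of the unitary matrix, so the sum to be bounded consists of square
  roots of probabilities with unimodular coefficients; their squares add up to 1, which makes square
  root cancellation a bound independent of the degree. The scale throughout is u, the fourth root of
  a binomial variance. The square roots of the weights have height about 1/u on a window of length
  about u^2, hence l^1 norm of order u and variation of order 1/u; Rudin--Shapiro sums over blocks
  of length u^2 are of order u, and Abel summation balances the two. The obstacle is that the inner
  sum depends on the row through its number m of trials. One more trial changes it by about 1 / sqrt
  (m * (1 - q)), which is not controlled as q tends to 1. Exchanging successes and failures
  exchanges q and 1 - q, hence the second sign pattern.\<close>

function rudin_shapiro :: "nat \<Rightarrow> real" where
  "rudin_shapiro n = (if n = 0 then 1
     else (if odd n \<and> odd (n div 2) then - 1 else 1) * rudin_shapiro (n div 2))"
  by auto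
termination by (relation "Wellfounded.measure id") auto

declare rudin_shapiro.simps [simp del]

lemma rudin_shapiro_double: "rudin_shapiro (2 * n) = rudin_shapiro n"
  by (cases "n = 0") (simp, subst rudin_shapiro.simps, simp)

text \<open>Appending the binary digit one creates a new pair of adjacent ones exactly when
  \<open>n\<close> is odd; the sequence is minus one to the number of such pairs.\<close>

lemma rudin_shapiro_double_Suc: "rudin_shapiro (Suc (2 * n)) = (- 1) ^ n * rudin_shapiro n"
  by (subst rudin_shapiro.simps) simp

lemma abs_rudin_shapiro [simp]: "\<bar>rudin_shapiro n\<bar> = 1"
proof (induction n rule: less_induct)
  case (less n)
  then show ?case
    by (subst rudin_shapiro.simps) (auto simp: abs_mult)
qed

definition rs_sum :: "nat \<Rightarrow> nat \<Rightarrow> complex \<Rightarrow> complex" where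
  "rs_sum a b z = (\<Sum>j\<in>{a..<b}. of_real (rudin_shapiro j) * z ^ j)"

lemma rs_sum_double:
  "rs_sum (2 * a) (2 * b) z = rs_sum a b (z\<^sup>2) + z * rs_sum a b (- z\<^sup>2)"
proof (cases "a \<le> b")
  case True
  then show ?thesis
  proof (induction b rule: dec_induct)
    case (step n)
    then have "rs_sum (2 * a) (2 * Suc n) z = rs_sum (2 * a) (2 * n) z
        + of_real (rudin_shapiro (2 * n)) * z ^ (2 * n)
        + of_real (rudin_shapiro (Suc (2 * n))) * z ^ Suc (2 * n)"
      by (simp add: rs_sum_def)
    also have "\<dots> = rs_sum a (Suc n) (z\<^sup>2) + z * rs_sum a (Suc n) (- z\<^sup>2)"
      using power_mult[of z 2 n] power_mult[of z n 2]
      unfolding rudin_shapiro_double rudin_shapiro_double_Suc step.IH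
      using step by (simp add: rs_sum_def power_minus[of "z\<^sup>2"] algebra_simps)
    finally show ?case .
  qed (simp add: rs_sum_def)
qed (simp add: rs_sum_def)

text \<open>The sums at \<open>z\<close> and \<open>- z\<close> are kept together because, by the
  parallelogram law, doubling the interval acts on the pair as sqrt 2 times an isometry. For one of
  them alone the triangle inequality would lose a factor 2 per doubling.\<close>

abbreviation rs_pair :: "nat \<Rightarrow> nat \<Rightarrow> complex \<Rightarrow> complex \<times> complex" where
  "rs_pair a b z \<equiv> (rs_sum a b z, rs_sum a b (- z))"

lemma norm_rs_pair_double:
  assumes "norm z = 1"
  shows "norm (rs_pair (2 * a) (2 * b) z) = sqrt 2 * norm (rs_pair a b (z\<^sup>2))"
proof -
  define x y where "x = rs_sum a b (z\<^sup>2)" and "y = z * rs_sum a b (- z\<^sup>2)"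
  have "(norm (x + y))\<^sup>2 + (norm (x - y))\<^sup>2 = 2 * ((norm x)\<^sup>2 + (norm y)\<^sup>2)"
    unfolding cmod_power2 by (simp add: power2_eq_square algebra_simps)
  moreover have "norm y = norm (rs_sum a b (- z\<^sup>2))"
    using assms by (simp add: y_def norm_mult)
  ultimately show ?thesis
    by (simp add: rs_sum_double norm_Pair x_def y_def flip: real_sqrt_mult)
qed

lemma norm_rs_pair_single: "norm z = 1 \<Longrightarrow> norm (rs_pair a (Suc a) z) = sqrt 2"
  by (simp add: rs_sum_def norm_Pair norm_mult norm_power)

lemma norm_rs_pair_append:
  assumes "norm z = 1" "a \<le> b" "b \<le> c"
  shows "norm (rs_pair a c z) \<le> norm (rs_pair a b z) + norm (rs_pair b c z)"
proof -
  have "rs_pair a c z = rs_pair a b z + rs_pair b c z"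
    using assms by (auto simp: rs_sum_def sum.atLeastLessThan_concat)
  then show ?thesis
    by (metis norm_triangle_ineq)
qed

text \<open>Shrinking the interval to even endpoints costs at most one term of norm sqrt 2 on each
  side, and the middle is a doubled interval. The subtracted 7 keeps these costs from accumulating,
  since 7 * (sqrt 2 - 1) >= 2 * sqrt 2; the 9 then makes length one and the empty middle
  work.\<close>

lemma norm_rs_pair_le:
  assumes "norm z = 1" "a < b"
  shows "norm (rs_pair a b z) \<le> 9 * sqrt (real (b - a)) - 7"
  using assms
proof (induction "b - a" arbitrary: a b z rule: less_induct)
  case less
  have s2: "sqrt 2 < 3 / 2" "7 / 5 < sqrt 2"
    by (rule real_less_lsqrt real_less_rsqrt; simp add: power2_eq_square)+
  show ?case
  proof (cases "b = Suc a")
    case True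
    then show ?thesis
      using norm_rs_pair_single[OF less.prems(1), of a] s2 by simp
  next
    case False
    define a' b' where "a' = (a + 1) div 2" and "b' = b div 2"
    have ab: "a \<le> 2 * a'" "2 * a' \<le> Suc a" "2 * b' \<le> b" "b \<le> Suc (2 * b')" "a' \<le> b'"
      using less.prems False by (auto simp: a'_def b'_def)
    have l: "norm (rs_pair a (2 * a') z) \<le> sqrt 2"
      using ab norm_rs_pair_single[OF less.prems(1), of a]
      by (cases "2 * a' = a") (auto simp: rs_sum_def norm_Pair le_Suc_eq)
    have r: "norm (rs_pair (2 * b') b z) \<le> sqrt 2"
      using ab norm_rs_pair_single[OF less.prems(1), of "2 * b'"]
      by (cases "2 * b' = b") (auto simp: rs_sum_def norm_Pair le_Suc_eq)
    have m: "norm (rs_pair (2 * a') (2 * b') z) \<le> 9 * sqrt (real (b - a)) - 7 - 2 * sqrt 2"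
    proof (cases "a' = b'")
      case True
      have "sqrt 2 \<le> sqrt (real (b - a))"
        using False less.prems by (intro real_sqrt_le_mono) auto
      then have "2 * sqrt 2 \<le> 9 * sqrt (real (b - a)) - 7"
        using s2 by linarith
      then show ?thesis
        using True by (simp add: rs_sum_def norm_Pair)
    next
      case False
      have "norm (rs_pair (2 * a') (2 * b') z) = sqrt 2 * norm (rs_pair a' b' (z\<^sup>2))"
        by (rule norm_rs_pair_double[OF less.prems(1)])
      also have "\<dots> \<le> sqrt 2 * (9 * sqrt (real (b' - a')) - 7)"
        using less.prems ab False
        by (intro mult_left_mono less.hyps) (auto simp: norm_power)
      also have "\<dots> = 9 * sqrt (real (2 * (b' - a'))) - 7 * sqrt 2"
        unfolding of_nat_mult real_sqrt_mult by (simp add: right_diff_distrib)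
      also have "\<dots> \<le> 9 * sqrt (real (b - a)) - 7 * sqrt 2"
      proof -
        have "2 * (b' - a') \<le> b - a"
          using ab by linarith
        then show ?thesis
          by (simp del: of_nat_mult)
      qed
      finally show ?thesis
        using s2 by simp
    qed
    have "norm (rs_pair a b z) \<le> norm (rs_pair a (2 * a') z) + norm (rs_pair (2 * a') (2 * b') z)
        + norm (rs_pair (2 * b') b z)"
      using norm_rs_pair_append[of z a "2 * a'" b] norm_rs_pair_append[of z "2 * a'" "2 * b'" b]
        less.prems ab by linarith
    then show ?thesis
      using l m r by linarith
  qed
qed

lemma norm_rs_sum_le:
  assumes "norm z = 1"
  shows "norm (rs_sum a b z) \<le> 9 * sqrt (real (b - a))"
proof (cases "a < b")
  case True
  then show ?thesis
    using norm_rs_pair_le[OF assms True] norm_fst_le[of "rs_sum a b z" "rs_sum a b (- z)"] by linarith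
qed (simp add: rs_sum_def)

section \<open>Abel summation against the Rudin--Shapiro sequence\<close>

lemma sum_by_parts:
  fixes x v :: "nat \<Rightarrow> 'a::comm_ring"
  assumes "c \<le> d"
  shows "(\<Sum>j\<in>{c..<Suc d}. x j * v j)
    = sum x {c..<Suc d} * v c + (\<Sum>j\<in>{c..<d}. sum x {Suc j..<Suc d} * (v (Suc j) - v j))"
  using assms
proof (induction c rule: inc_induct)
  case (step c)
  then show ?case
    by (simp add: sum.atLeast_Suc_lessThan algebra_simps)
qed simp

lemma norm_sum_by_parts_le:
  fixes x v :: "nat \<Rightarrow> 'a::{comm_ring,real_normed_algebra}"
  assumes "c \<le> d" and M: "\<And>a. c \<le> a \<Longrightarrow> a \<le> d \<Longrightarrow> norm (sum x {a..<Suc d}) \<le> M"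
  shows "norm (\<Sum>j\<in>{c..<Suc d}. x j * v j)
    \<le> M * (norm (v c) + (\<Sum>j\<in>{c..<d}. norm (v (Suc j) - v j)))"
proof -
  have "norm (\<Sum>j\<in>{c..<Suc d}. x j * v j) \<le> norm (sum x {c..<Suc d} * v c)
      + norm (\<Sum>j\<in>{c..<d}. sum x {Suc j..<Suc d} * (v (Suc j) - v j))"
    unfolding sum_by_parts[OF \<open>c \<le> d\<close>] by (rule norm_triangle_ineq)
  also have "\<dots> \<le> M * norm (v c) + (\<Sum>j\<in>{c..<d}. M * norm (v (Suc j) - v j))"
    using assms
    by (intro add_mono norm_mult_ineq[THEN order_trans] sum_norm_le mult_right_mono) auto
  finally show ?thesis
    by (simp add: sum_distrib_left algebra_simps)
qed

lemma norm_diff_le_variation: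
  fixes v :: "nat \<Rightarrow> 'a::real_normed_vector"
  assumes "i \<le> j"
  shows "norm (v j - v i) \<le> (\<Sum>l\<in>{i..<j}. norm (v (Suc l) - v l))"
  using sum_Suc_diff'[OF assms, of v] norm_sum[of "\<lambda>l. v (Suc l) - v l" "{i..<j}"] by simp

text \<open>Any two values differ by at most the variation; averaging over \<open>j\<close> gives
  the claim. The endpoint value left over by Abel summation is thereby traded for an l^1
  average.\<close>

lemma norm_le_mean_plus_variation:
  fixes v :: "nat \<Rightarrow> 'a::real_normed_vector"
  assumes "0 < L" "i \<in> {a..<a + L}"
  shows "norm (v i) \<le> (\<Sum>j\<in>{a..<a + L}. norm (v j)) / L
    + (\<Sum>j\<in>{a..<a + L - 1}. norm (v (Suc j) - v j))"
proof -
  define V where "V = (\<Sum>j\<in>{a..<a + L - 1}. norm (v (Suc j) - v j))"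
  have "norm (v i) \<le> norm (v j) + V" if "j \<in> {a..<a + L}" for j
  proof -
    have "norm (v (max i j) - v (min i j)) \<le> (\<Sum>l\<in>{min i j..<max i j}. norm (v (Suc l) - v l))"
      by (rule norm_diff_le_variation) simp
    also have "\<dots> \<le> V"
      unfolding V_def using that assms by (intro sum_mono2) auto
    finally have "norm (v i - v j) \<le> V"
      by (auto simp: max_def min_def norm_minus_commute split: if_splits)
    then show ?thesis
      using norm_triangle_ineq2[of "v i" "v j"] by linarith
  qed
  then have "(\<Sum>j\<in>{a..<a + L}. norm (v i)) \<le> (\<Sum>j\<in>{a..<a + L}. norm (v j) + V)"
    by (intro sum_mono)
  then have "L * norm (v i) \<le> (\<Sum>j\<in>{a..<a + L}. norm (v j)) + L * V"
    by (simp add: sum.distrib)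
  then have "norm (v i) \<le> (\<Sum>j\<in>{a..<a + L}. norm (v j)) / L + V"
    using assms by (simp add: field_simps)
  then show ?thesis
    by (simp add: V_def)
qed

text \<open>The sequence \<open>v\<close> is cut into blocks of length comparable to \<open>k\<close>, on each of which
  summation by parts exploits the square root cancellation of the Rudin--Shapiro sequence.\<close>

lemma norm_rs_weighted_sum_blocks:
  fixes v :: "nat \<Rightarrow> complex"
  assumes z: "norm z = 1" and k: "0 < k" "k \<le> L"
  shows "norm (\<Sum>j\<in>{max a c..<min d (a + L)}. of_real (rudin_shapiro j) * z ^ j * v j)
    \<le> 36 * ((\<Sum>j\<in>{a..<a + L}. norm (v j)) / sqrt k
             + sqrt k * (\<Sum>j\<in>{a..<a + L - 1}. norm (v (Suc j) - v j)))"
  using k(2)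
proof (induction L arbitrary: a rule: less_induct)
  case (less L)
  let ?x = "\<lambda>j. of_real (rudin_shapiro j) * z ^ j"
  show ?case
  \<comment> \<open>Blocks of length \<open>k\<close> are split off while at least
    \<open>2 * k\<close> is left, so the last block has length between \<open>k\<close> and
    \<open>2 * k\<close>.\<close>
  proof (cases "L < 2 * k")
    case True
    define c' d' where "c' = max a c" and "d' = min d (a + L)"
    define V S where "V = (\<Sum>j\<in>{a..<a + L - 1}. norm (v (Suc j) - v j))"
      and "S = (\<Sum>j\<in>{a..<a + L}. norm (v j))"
    have VS: "V \<ge> 0" "S \<ge> 0"
      by (auto simp: V_def S_def sum_nonneg)
    show ?thesis
    proof (cases "c' < d'")
      case False
      then show ?thesis
        unfolding c'_def[symmetric] d'_def[symmetric] V_def[symmetric] S_def[symmetric]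
        using VS by simp
    next
      case c'd': True
      define e where "e = d' - 1"
      have e: "Suc e = d'" "c' \<le> e"
        using c'd' by (auto simp: e_def)
      have M: "norm (sum ?x {i..<Suc e}) \<le> 9 * sqrt (2 * k)" if "c' \<le> i" for i
      proof -
        have "real (Suc e - i) \<le> 2 * k"
          using True that e by (auto simp: c'_def d'_def)
        moreover have "norm (sum ?x {i..<Suc e}) \<le> 9 * sqrt (Suc e - i)"
          using norm_rs_sum_le[OF z, of i "Suc e"] by (simp only: rs_sum_def)
        ultimately show ?thesis
          using real_sqrt_le_mono by (smt (verit))
      qed
      have "norm (\<Sum>j\<in>{c'..<Suc e}. ?x j * v j)
          \<le> 9 * sqrt (2 * k) * (norm (v c') + (\<Sum>j\<in>{c'..<e}. norm (v (Suc j) - v j)))"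
        using e M by (intro norm_sum_by_parts_le) auto
      also have "\<dots> \<le> 9 * sqrt (2 * k) * ((S / L + V) + V)"
      proof -
        \<comment> \<open>The window from \<open>c\<close> to \<open>d\<close> may meet the block in
          very few points; the average is therefore taken over the whole block, whose length is at
          least \<open>k\<close>.\<close>
        have "norm (v c') \<le> S / L + V"
          unfolding S_def V_def using c'd' k less.prems
          by (intro norm_le_mean_plus_variation) (auto simp: c'_def d'_def)
        moreover have "(\<Sum>j\<in>{c'..<e}. norm (v (Suc j) - v j)) \<le> V"
          unfolding V_def using e by (intro sum_mono2) (auto simp: c'_def d'_def)
        ultimately show ?thesis
          by (intro mult_left_mono) auto
      qed
      also have "\<dots> \<le> 9 * sqrt (2 * k) * (S / k + 2 * V)"
        using k less.prems VS by (intro mult_left_mono) (auto intro!: divide_left_mono)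
      also have "\<dots> = 9 * sqrt 2 * (S / sqrt k + 2 * (sqrt k * V))"
        using k by (simp add: real_sqrt_mult field_simps)
      also have "\<dots> \<le> 18 * (2 * (S / sqrt k) + 2 * (sqrt k * V))"
        using VS k real_sqrt_le_mono[of 2 4]
        by (intro mult_mono add_mono) (auto simp: divide_right_mono)
      finally show ?thesis
        unfolding c'_def[symmetric] d'_def[symmetric] V_def[symmetric] S_def[symmetric] e(1)
        by (simp add: algebra_simps)
    qed
  next
    case False
    define L' where "L' = L - k"
    have L: "L = k + L'" "k \<le> L'" "k < L" "L' < L"
      using False k by (auto simp: L'_def)
    let ?S = "\<lambda>a L. \<Sum>j\<in>{a..<a + L}. norm (v j)"
    let ?V = "\<lambda>a L. \<Sum>j\<in>{a..<a + L - 1}. norm (v (Suc j) - v j)"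
    let ?T = "\<lambda>a L. \<Sum>j\<in>{max a c..<min d (a + L)}. ?x j * v j"
    have T: "?T a L = ?T a k + ?T (a + k) L'"
    proof -
      have "{max a c..<min d (a + L)}
          = {max a c..<min d (a + k)} \<union> {max (a + k) c..<min d (a + k + L')}"
        unfolding L(1) by (rule set_eqI, simp, presburger)
      then show ?thesis
        by (simp only:) (rule sum.union_disjoint; simp add: disjoint_iff)
    qed
    have "norm (?T a L) \<le> norm (?T a k) + norm (?T (a + k) L')"
      unfolding T by (rule norm_triangle_ineq)
    also have "\<dots> \<le> 36 * (?S a k / sqrt k + sqrt k * ?V a k)
        + 36 * (?S (a + k) L' / sqrt k + sqrt k * ?V (a + k) L')"
      using L by (intro add_mono less.IH) auto
    also have "\<dots> = 36 * ((?S a k + ?S (a + k) L') / sqrt k + sqrt k * (?V a k + ?V (a + k) L'))"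
      by (simp add: algebra_simps add_divide_distrib)
    also have "?S a k + ?S (a + k) L' = ?S a L"
      using L sum.atLeastLessThan_concat[of a "a + k" "a + L" "\<lambda>j. norm (v j)"]
      by (simp add: add.assoc)
    also have "36 * (?S a L / sqrt k + sqrt k * (?V a k + ?V (a + k) L'))
        \<le> 36 * (?S a L / sqrt k + sqrt k * ?V a L)"
    proof -
      have "?V a k + ?V (a + k) L'
          = (\<Sum>j\<in>{a..<a + k - 1} \<union> {a + k..<a + k + L' - 1}. norm (v (Suc j) - v j))"
        by (intro sum.union_disjoint[symmetric]) auto
      also have "\<dots> \<le> ?V a L"
        using L by (intro sum_mono2) auto
      finally show ?thesis
        by (intro mult_left_mono add_left_mono) auto
    qed
    finally show ?thesis .
  qed
qed

text \<open>The bound does not depend on the cut-offs \<open>c\<close> and \<open>d\<close>. They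
  are there because folding the triangle leads to sums over only part of its rows.\<close>

lemma norm_rs_weighted_sum:
  fixes v :: "nat \<Rightarrow> complex"
  assumes "norm z = 1" "0 < k" "k \<le> L" "d \<le> L"
  shows "norm (\<Sum>j\<in>{c..<d}. of_real (rudin_shapiro j) * z ^ j * v j)
    \<le> 36 * ((\<Sum>j<L. norm (v j)) / sqrt k + sqrt k * (\<Sum>j<L - 1. norm (v (Suc j) - v j)))"
  using norm_rs_weighted_sum_blocks[where a = 0 and L = L and c = c and d = d and v = v] assms
  by (simp add: min_absorb1 atLeast0LessThan)

section \<open>Square roots of binomial weights\<close>

text \<open>By the mean value theorem the increment is \<open>h\<close> times the derivative at a
  point y within distance 1 of \<open>x\<close>, where 1 + y^2 is at most 3 * (1 + x^2). It compares
  a Lorentzian sum with a telescoping one of total increment at most pi.\<close>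

lemma lorentzian_le_arctan_diff:
  fixes x h :: real
  assumes "0 < h" "h \<le> 1"
  shows "h / (1 + x\<^sup>2) \<le> 3 * (arctan (x + h) - arctan x)"
proof -
  obtain y where y: "x < y" "y < x + h" "arctan (x + h) - arctan x = h * inverse (1 + y\<^sup>2)"
    using MVT2[of x "x + h" arctan "\<lambda>y. inverse (1 + y\<^sup>2)"] assms DERIV_arctan by auto
  define e where "e = (y - x)\<^sup>2"
  have "y\<^sup>2 \<le> 2 * x\<^sup>2 + 2 * e"
    using sum_power2_ge_zero[of "y - 2 * x" 0] by (simp add: e_def power2_eq_square algebra_simps)
  moreover have "e \<le> 1"
    using y assms by (simp add: e_def power_le_one)
  ultimately have "1 + y\<^sup>2 \<le> 3 * (1 + x\<^sup>2)"
    using zero_le_power2[of x] by argo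
  moreover have "0 < 1 + y\<^sup>2" "0 < 1 + x\<^sup>2"
    by (simp_all add: add_pos_nonneg)
  ultimately have "inverse (1 + x\<^sup>2) \<le> 3 * inverse (1 + y\<^sup>2)"
    by (simp add: divide_simps)
  then have "h * inverse (1 + x\<^sup>2) \<le> h * (3 * inverse (1 + y\<^sup>2))"
    using assms by (intro mult_left_mono) auto
  then show ?thesis
    using y(3) by (simp add: divide_inverse)
qed

lemma sum_lorentzian_le:
  fixes c s :: real
  assumes "1 \<le> s"
  shows "(\<Sum>j<n. 1 / (1 + ((real j - c) / s)\<^sup>2)) \<le> 10 * s"
proof -
  have "1 / (1 + ((real j - c) / s)\<^sup>2)
      \<le> 3 * s * (arctan ((real (Suc j) - c) / s) - arctan ((real j - c) / s))" for j
  proof -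
    have "(1 / s) / (1 + ((real j - c) / s)\<^sup>2)
        \<le> 3 * (arctan ((real j - c) / s + 1 / s) - arctan ((real j - c) / s))"
      using assms by (intro lorentzian_le_arctan_diff) auto
    moreover have "(real j - c) / s + 1 / s = (real (Suc j) - c) / s"
      by (simp add: add_divide_distrib[symmetric])
    ultimately have "s * ((1 / s) / (1 + ((real j - c) / s)\<^sup>2))
        \<le> s * (3 * (arctan ((real (Suc j) - c) / s) - arctan ((real j - c) / s)))"
      using assms by (intro mult_left_mono) auto
    then show ?thesis
      using assms by (simp add: mult_ac)
  qed
  then have "(\<Sum>j<n. 1 / (1 + ((real j - c) / s)\<^sup>2))
      \<le> (\<Sum>j<n. 3 * s * (arctan ((real (Suc j) - c) / s) - arctan ((real j - c) / s)))"
    by (intro sum_mono)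
  also have "\<dots> = 3 * s * (arctan ((real n - c) / s) - arctan ((real 0 - c) / s))"
    unfolding sum_distrib_left[symmetric]
    using sum_lessThan_telescope[of "\<lambda>j. arctan ((real j - c) / s)" n] by simp
  also have "\<dots> \<le> 3 * s * pi"
    using assms arctan_ubound[of "(real n - c) / s"] arctan_lbound[of "(real 0 - c) / s"]
    by (intro mult_left_mono) linarith+
  also have "\<dots> \<le> 3 * s * (10 / 3)"
    using assms pi_less_4 pi_approx by (intro mult_left_mono) auto
  finally show ?thesis
    by simp
qed

section \<open>The l^1 norm of the square roots\<close>

definition sqrt_bern :: "nat \<Rightarrow> real \<Rightarrow> nat \<Rightarrow> real" where
  "sqrt_bern m q j = sqrt (Bernstein m j q)"

lemma sqrt_bern_nonneg: "0 \<le> q \<Longrightarrow> q \<le> 1 \<Longrightarrow> 0 \<le> sqrt_bern m q j"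
  by (simp add: sqrt_bern_def Bernstein_nonneg)

lemma sqrt_bern_sq: "0 \<le> q \<Longrightarrow> q \<le> 1 \<Longrightarrow> (sqrt_bern m q j)\<^sup>2 = Bernstein m j q"
  by (simp add: sqrt_bern_def Bernstein_nonneg)

lemma sqrt_bern_eq_0: "m < j \<Longrightarrow> sqrt_bern m q j = 0"
  by (simp add: sqrt_bern_def Bernstein_def)

lemma Bernstein_variance:
  fixes q :: real
  shows "(\<Sum>j\<le>m. (real j - m * q)\<^sup>2 * Bernstein m j q) = m * q * (1 - q)"
proof -
  have "(real j - m * q)\<^sup>2 * Bernstein m j q = real j * (real j - 1) * Bernstein m j q
      + (1 - 2 * m * q) * (real j * Bernstein m j q) + (m * q)\<^sup>2 * Bernstein m j q" for j
    by (simp add: power2_eq_square algebra_simps)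
  then have "(\<Sum>j\<le>m. (real j - m * q)\<^sup>2 * Bernstein m j q)
      = real m * (real m - 1) * q\<^sup>2 + (1 - 2 * m * q) * (m * q) + (m * q)\<^sup>2"
    by (simp add: sum.distrib flip: sum_distrib_left)
  then show ?thesis
    by (simp add: power2_eq_square algebra_simps)
qed

text \<open>Cauchy--Schwarz against 1 + x^2, where x is the deviation from the mean in units of w^2,
  which is at least the standard deviation. The variance bounds one factor by 2, the Lorentzian sum
  bounds the other by 10 * w^2, and 20 <= 25.\<close>

lemma sum_sqrt_bern_le:
  fixes q w :: real
  assumes q: "0 \<le> q" "q \<le> 1" and w: "1 \<le> w" "m * q * (1 - q) + 1 \<le> w ^ 4"
  shows "(\<Sum>j\<le>m. sqrt_bern m q j) \<le> 5 * w"
proof -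
  define x where "x j = (real j - m * q) / w\<^sup>2" for j
  have x: "0 < 1 + (x j)\<^sup>2" for j
    by (simp add: add_pos_nonneg)
  have w4: "(w\<^sup>2)\<^sup>2 = w ^ 4"
    by (simp flip: power_mult)
  have "(\<Sum>j\<le>m. sqrt_bern m q j)\<^sup>2
      = (\<Sum>j\<le>m. (sqrt_bern m q j * sqrt (1 + (x j)\<^sup>2)) * sqrt (1 / (1 + (x j)\<^sup>2)))\<^sup>2"
    using x by (simp add: real_sqrt_divide less_imp_neq[symmetric])
  also have "\<dots> \<le> (\<Sum>j\<le>m. (sqrt_bern m q j * sqrt (1 + (x j)\<^sup>2))\<^sup>2)
      * (\<Sum>j\<le>m. (sqrt (1 / (1 + (x j)\<^sup>2)))\<^sup>2)"
    by (rule Cauchy_Schwarz_ineq_sum)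
  also have "(\<Sum>j\<le>m. (sqrt_bern m q j * sqrt (1 + (x j)\<^sup>2))\<^sup>2)
      = (\<Sum>j\<le>m. Bernstein m j q + (real j - m * q)\<^sup>2 * Bernstein m j q / w ^ 4)"
    using x q by (simp add: power_mult_distrib sqrt_bern_sq less_imp_le x_def power_divide w4
        algebra_simps)
  also have "\<dots> = 1 + m * q * (1 - q) / w ^ 4"
    by (simp add: sum.distrib Bernstein_variance flip: sum_divide_distrib)
  also have "(\<Sum>j\<le>m. (sqrt (1 / (1 + (x j)\<^sup>2)))\<^sup>2) = (\<Sum>j<Suc m. 1 / (1 + ((real j - m * q) / w\<^sup>2)\<^sup>2))"
    using x by (simp add: less_imp_le lessThan_Suc_atMost x_def del: sum.lessThan_Suc)
  also have "(1 + m * q * (1 - q) / w ^ 4) * \<dots> \<le> 2 * (10 * w\<^sup>2)"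
  proof (rule mult_mono)
    show "1 + m * q * (1 - q) / w ^ 4 \<le> 2"
      using w by (simp add: divide_le_eq)
    show "(\<Sum>j<Suc m. 1 / (1 + ((real j - m * q) / w\<^sup>2)\<^sup>2)) \<le> 10 * w\<^sup>2"
      using w by (intro sum_lorentzian_le) auto
  qed (auto intro!: sum_nonneg divide_nonneg_nonneg simp del: sum.lessThan_Suc)
  also have "\<dots> \<le> (5 * w)\<^sup>2"
    by (simp add: power_mult_distrib)
  finally show ?thesis
    by (rule power2_le_imp_le) (use w in simp)
qed

text \<open>The square root of a likelihood ratio: \<open>sqrt_bern m q (j - 1)\<close> over
  \<open>sqrt_bern m q j\<close>, with the value 0 at \<open>j = 0\<close>, where there is no
  predecessor.\<close>

definition bern_ratio :: "nat \<Rightarrow> real \<Rightarrow> nat \<Rightarrow> real" where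
  "bern_ratio m q j = sqrt (j * (1 - q) / ((real m + 1 - j) * q))"

lemma bern_ratio_0 [simp]: "bern_ratio m q 0 = 0"
  by (simp add: bern_ratio_def)

lemma sqrt_bern_pred:
  assumes "0 < q" "q < 1" "j < m"
  shows "sqrt_bern m q j = sqrt_bern m q (Suc j) * bern_ratio m q (Suc j)"
proof -
  obtain d where m: "m = Suc (j + d)"
    using assms less_imp_Suc_add by blast
  have "real (m choose j) * (Suc d) = real (m choose Suc j) * Suc j"
    using binomial_absorb_comp[of m j] binomial_absorption[of j m]
    unfolding m by (metis Suc_diff_le add_diff_cancel_left' diff_Suc_1 le_add1 mult.commute of_nat_mult)
  moreover define A B where "A = real (m choose j)" and "B = real (m choose Suc j)"
  ultimately have A: "A = B * (1 + real j) / (1 + real d)"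
    by (simp add: field_simps)
  then have "Bernstein m j q
      = Bernstein m (Suc j) q * (Suc j * (1 - q) / ((real m + 1 - Suc j) * q))"
    using assms unfolding Bernstein_def A_def[symmetric] B_def[symmetric] A
    by (simp add: m)
  then show ?thesis
    by (simp add: sqrt_bern_def bern_ratio_def flip: real_sqrt_mult)
qed

lemma bern_ratio_mono:
  assumes "0 < q" "q < 1" "j < m"
  shows "bern_ratio m q j \<le> bern_ratio m q (Suc j)"
  unfolding bern_ratio_def using assms
  by (intro real_sqrt_le_mono frac_le mult_mono) auto

text \<open>The increment of the ratio is at most the increment of its square over the larger ratio.
  Multiplied by the weight, this is essentially the root of another binomial weight: the factors j +
  1 and m - j in the denominators are absorbed by four more trials, one success and three failures.
  So the l^1 bound applies to the right-hand side.\<close>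

lemma sqrt_bern_ratio_increment_le:
  assumes q: "0 < q" "q < 1" and "j < m"
  shows "sqrt_bern m q j * (bern_ratio m q (Suc j) - bern_ratio m q j)
    \<le> 3 / ((real m + 1) * q * (1 - q)) * sqrt_bern (m + 4) q (Suc j)"
proof -
  obtain e where m: "m = Suc (j + e)"
    using \<open>j < m\<close> less_imp_Suc_add by blast
  define d M where "d = real e + 1" and "M = real m + 1"
  have pos: "1 \<le> d" "0 < M" "0 < 1 - q"
    using q by (auto simp: d_def M_def)
  define X where "X = (1 - q) / q * M / ((d + 1) * d)"
  define t where "t = bern_ratio m q (Suc j)"
  define P where "P = (real j + 1) * (d + 1)"
  have t2: "t\<^sup>2 = (real j + 1) * (1 - q) / (d * q)"
    using q pos by (simp add: t_def bern_ratio_def m d_def add.commute)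
  have t: "0 < t"
    using q pos by (simp add: t_def bern_ratio_def m)
  have s2: "(bern_ratio m q j)\<^sup>2 = j * (1 - q) / ((d + 1) * q)"
    using q pos by (simp add: bern_ratio_def m d_def)
  have "t\<^sup>2 - (bern_ratio m q j)\<^sup>2 = X"
  proof -
    have "M = j + d + 1"
      by (simp add: M_def d_def m)
    moreover have "d + 1 \<noteq> 0"
      using pos by simp
    ultimately show ?thesis
      unfolding t2 s2 X_def using q pos by (simp add: divide_simps) (simp add: algebra_simps)
  qed
  then have "X = (t - bern_ratio m q j) * (t + bern_ratio m q j)"
    by (simp add: power2_eq_square algebra_simps)
  also have "\<dots> \<ge> (t - bern_ratio m q j) * t"
    using bern_ratio_mono[OF assms] q
    by (intro mult_left_mono) (auto simp: t_def bern_ratio_def m)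
  finally have "t - bern_ratio m q j \<le> X / t"
    using t by (simp add: field_simps)
  then have "sqrt_bern m q j * (t - bern_ratio m q j) \<le> sqrt_bern m q j * (X / t)"
    using q by (intro mult_left_mono sqrt_bern_nonneg) auto
  also have "\<dots> \<le> 3 / (M * q * (1 - q)) * sqrt_bern (m + 4) q (Suc j)"
  proof (rule power2_le_imp_le)
    define K where "K = real (m choose j) * q ^ j * (1 - q) ^ Suc e"
    have K: "0 \<le> K"
      using q by (simp add: K_def)
    have B: "Bernstein m j q = K"
      by (simp add: Bernstein_def m K_def)
    have "real ((m + 4) choose Suc j)
        = real (m choose j) * (M * (M + 1) * (M + 2) * (M + 3)) / (P * ((d + 2) * (d + 3)))"
    proof -
      have "real (m choose j) = fact m / (fact j * fact (Suc e))"
        by (subst binomial_fact) (auto simp: m)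
      moreover have "real ((m + 4) choose Suc j) = fact (m + 4) / (fact (Suc j) * fact (e + 4))"
        by (subst binomial_fact) (auto simp: m add.commute)
      moreover have "fact (m + 4) = (fact m * (M * (M + 1) * (M + 2) * (M + 3)) :: real)"
        by (simp add: M_def numeral_eq_Suc algebra_simps)
      moreover have "fact (e + 4) = (fact (Suc e) * ((d + 1) * (d + 2) * (d + 3)) :: real)"
        by (simp add: d_def numeral_eq_Suc algebra_simps)
      moreover have "fact (Suc j) = (fact j * (real j + 1) :: real)"
        by simp
      ultimately show ?thesis
        by (simp add: P_def)
    qed
    moreover have "m + 4 - Suc j = Suc e + 3"
      by (simp add: m)
    ultimately have B4: "Bernstein (m + 4) (Suc j) q = K * (q * (1 - q) ^ 3)
        * (M * (M + 1) * (M + 2) * (M + 3)) / (P * ((d + 2) * (d + 3)))"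
      unfolding Bernstein_def by (simp add: K_def power_add power3_eq_cube power4_eq_xxxx)
    have "(sqrt_bern m q j * (X / t))\<^sup>2 = K * ((1 - q) / q) * (1 / P) * (M\<^sup>2 / (d * (d + 1)))"
    proof -
      have "K * ((r / q * M / (D * d))\<^sup>2 / (J * r / (d * q)))
          = K * (r / q) * (1 / (J * D)) * (M\<^sup>2 / (d * D))"
        if "r \<noteq> 0" "D \<noteq> 0" "J \<noteq> 0" for r D J
        using that q pos by (simp add: field_simps power2_eq_square)
      from this[of "1 - q" "d + 1" "real j + 1"] show ?thesis
        using q pos unfolding power_mult_distrib[of "sqrt_bern m q j"] power_divide[of X t] t2
        unfolding sqrt_bern_sq[OF less_imp_le[OF q(1)] less_imp_le[OF q(2)]] B X_def P_def by simp
    qed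
    also have "\<dots> \<le> K * ((1 - q) / q) * (1 / P)
        * (9 / M\<^sup>2 * (M * (M + 1) * (M + 2) * (M + 3)) / ((d + 2) * (d + 3)))"
    proof (rule mult_left_mono)
      have "M\<^sup>2 / (d * (d + 1)) = M ^ 4 / (M\<^sup>2 * (d * (d + 1)))"
        using pos by (simp add: power2_eq_square power4_eq_xxxx)
      also have "\<dots> \<le> (M * (M + 1) * (M + 2) * (M + 3)) / (M\<^sup>2 * ((d + 2) * (d + 3) / 9))"
      proof (rule frac_le)
        have "(d + 2) * (d + 3) \<le> 9 * (d * (d + 1))"
          using pos mult_mono[of 1 d 1 d] by (simp add: algebra_simps)
        then show "M\<^sup>2 * ((d + 2) * (d + 3) / 9) \<le> M\<^sup>2 * (d * (d + 1))"
          by (intro mult_left_mono) auto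
        show "M ^ 4 \<le> M * (M + 1) * (M + 2) * (M + 3)"
          unfolding power4_eq_xxxx using pos by (intro mult_mono) auto
      qed (use pos in auto)
      finally show "M\<^sup>2 / (d * (d + 1))
          \<le> 9 / M\<^sup>2 * (M * (M + 1) * (M + 2) * (M + 3)) / ((d + 2) * (d + 3))"
        by (simp add: field_simps)
    qed (use K q pos in \<open>auto simp: P_def\<close>)
    also have "\<dots> = (3 / (M * q * (1 - q)) * sqrt_bern (m + 4) q (Suc j))\<^sup>2"
    proof -
      have "K * (r / q) * (1 / P) * (9 / M\<^sup>2 * F / E)
          = (3 / (M * q * r))\<^sup>2 * (K * (q * r ^ 3) * F / (P * E))"
        if "r \<noteq> 0" "E \<noteq> 0" "P \<noteq> 0" for r E F P
        using that q pos by (simp add: field_simps power2_eq_square power3_eq_cube)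
      from this[of "1 - q" "(d + 2) * (d + 3)" P "M * (M + 1) * (M + 2) * (M + 3)"] show ?thesis
        unfolding power_mult_distrib[of _ "sqrt_bern (m + 4) q (Suc j)"]
          sqrt_bern_sq[OF less_imp_le[OF q(1)] less_imp_le[OF q(2)]] B4
        using q pos by (simp add: P_def)
    qed
    finally show "(sqrt_bern m q j * (X / t))\<^sup>2
        \<le> (3 / (M * q * (1 - q)) * sqrt_bern (m + 4) q (Suc j))\<^sup>2" .
      have "0 \<le> sqrt_bern (m + 4) q (Suc j)"
      using q by (intro sqrt_bern_nonneg) auto
    then show "0 \<le> 3 / (M * q * (1 - q)) * sqrt_bern (m + 4) q (Suc j)"
      using q pos by simp
  qed
  finally show ?thesis
    by (simp add: t_def M_def)
qed


text \<open>The block length is the integer part of u^2, whose square root lies between u / 2 and u;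
  this rounding doubles the constant 36.\<close>

lemma norm_rs_weighted_sum_scale:
  fixes v :: "nat \<Rightarrow> complex" and u :: real
  assumes z: "norm z = 1" and u: "1 \<le> u" "u\<^sup>2 \<le> L" and d: "d \<le> L"
  shows "norm (\<Sum>j\<in>{c..<d}. of_real (rudin_shapiro j) * z ^ j * v j)
    \<le> 72 * ((\<Sum>j<L. norm (v j)) / u + u * (\<Sum>j<L - 1. norm (v (Suc j) - v j)))"
proof -
  define k where "k = nat \<lfloor>u\<^sup>2\<rfloor>"
  have u2: "1 \<le> u\<^sup>2"
    using u by simp
  then have "1 \<le> \<lfloor>u\<^sup>2\<rfloor>"
    by (simp add: le_floor_iff)
  then have "1 \<le> real k" "real k \<le> u\<^sup>2" "u\<^sup>2 \<le> real k + 1"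
    unfolding k_def using of_int_floor_le[of "u\<^sup>2"] real_of_int_floor_add_one_ge[of "u\<^sup>2"] by auto
  then have k: "0 < k" "k \<le> L" "real k \<le> u\<^sup>2" "u\<^sup>2 \<le> 4 * real k"
    using u by linarith+
  have "sqrt k \<le> u"
    using k u by (simp add: real_le_lsqrt)
  moreover have "u \<le> 2 * sqrt k"
    using real_sqrt_le_mono[OF k(4)] u by (simp add: real_sqrt_mult)
  then have "1 / sqrt k \<le> 2 / u"
    using k u by (simp add: field_simps)
  ultimately have "(\<Sum>j<L. norm (v j)) * (1 / sqrt k)
      + sqrt k * (\<Sum>j<L - 1. norm (v (Suc j) - v j))
      \<le> (\<Sum>j<L. norm (v j)) * (2 / u) + (2 * u) * (\<Sum>j<L - 1. norm (v (Suc j) - v j))"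
    using u by (intro add_mono mult_left_mono mult_right_mono sum_nonneg) auto
  then show ?thesis
    using norm_rs_weighted_sum[OF z k(1,2) d, where c = c and v = v] by simp
qed

lemma power_le_exp_complement:
  fixes x :: real
  assumes "0 \<le> x"
  shows "x ^ m \<le> exp (- (m * (1 - x)))"
proof -
  have "x ^ m \<le> exp (x - 1) ^ m"
    using exp_ge_add_one_self[of "x - 1"] assms by (intro power_mono) auto
  also have "\<dots> = exp (- (m * (1 - x)))"
    by (simp add: exp_of_nat_mult[symmetric] algebra_simps)
  finally show ?thesis .
qed

text \<open>Exponential decay beats the powers of \<open>u\<close>. It serves for the two extreme
  binomial weights, which are the pure powers of 1 - q and q.\<close>

lemma sqrt_power_le:
  fixes x u :: real
  assumes x: "0 \<le> x" "x \<le> 1" and u: "1 \<le> u" "u ^ 4 \<le> m * (1 - x)"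
  shows "sqrt (x ^ m) \<le> 2 / u ^ 3"
proof -
  define y where "y = m * (1 - x)"
  have y: "u ^ 4 \<le> y" "0 < y"
    using u by (auto simp: y_def intro: less_le_trans[of 0 "u ^ 4"])
  have "u ^ 6 \<le> u ^ 8"
    using u by (intro power_increasing) auto
  also have "u ^ 8 = (u ^ 4)\<^sup>2"
    by (simp flip: power_mult)
  also have "\<dots> \<le> y\<^sup>2"
    using y by (intro power_mono) auto
  also have "\<dots> \<le> 4 * exp y"
    using exp_lower_Taylor_quadratic[of y] y exp_gt_zero[of y] by linarith
  finally have "exp (- y) \<le> 4 / u ^ 6"
    using u by (simp add: exp_minus field_simps)
  then have "x ^ m \<le> 4 / u ^ 6"
    using power_le_exp_complement[OF x(1), of m] by (simp add: y_def)
  also have "\<dots> = (2 / u ^ 3)\<^sup>2"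
    by (simp add: power_divide flip: power_mult)
  finally show ?thesis
    using u by (simp add: real_le_lsqrt)
qed

lemma sum_sqrt_bern_le_6:
  fixes q u :: real
  assumes "0 \<le> q" "q \<le> 1" "1 \<le> u" "m * q * (1 - q) \<le> u ^ 4"
  shows "(\<Sum>j\<le>m. sqrt_bern m q j) \<le> 6 * u"
proof -
  \<comment> \<open>Since (6 / 5)^4 > 2 and u^4 >= 1, the slightly larger scale pays for the added
    1.\<close>
  have "m * q * (1 - q) + 1 \<le> (6 / 5 * u) ^ 4"
    using assms(4) one_le_power[OF assms(3), of 4] unfolding power_mult_distrib power_divide
    by simp
  then show ?thesis
    using sum_sqrt_bern_le[of q "6 / 5 * u" m] assms by simp
qed

section \<open>Variation of the square roots for variance at least 1\<close>

context
  fixes m :: nat and q u :: real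
  assumes q: "0 < q" "q < 1" and u: "1 \<le> u" and V: "m * q * (1 - q) = u ^ 4"
begin

lemma ratio_variation:
  "(\<Sum>j<m. sqrt_bern m q j * (bern_ratio m q (Suc j) - bern_ratio m q j)) \<le> 21 / u ^ 3"
proof -
  have u4: "1 \<le> u ^ 4"
    using u by simp
  have q1: "q * (1 - q) \<le> 1 / 4"
    using zero_le_power2[of "q - 1 / 2"] by (simp add: power2_eq_square algebra_simps)
  have "(\<Sum>j<m. sqrt_bern (m + 4) q (Suc j)) = (\<Sum>j\<in>{1..<Suc m}. sqrt_bern (m + 4) q j)"
    by (simp add: sum.shift_bounds_Suc_ivl lessThan_atLeast0 del: sum.op_ivl_Suc)
  also have "\<dots> \<le> (\<Sum>j\<le>m + 4. sqrt_bern (m + 4) q j)"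
    using q by (intro sum_mono2 sqrt_bern_nonneg) auto
  also have "\<dots> \<le> 5 * (4 / 3 * u)"
  proof (rule sum_sqrt_bern_le)
    have "real (m + 4) * q * (1 - q) + 1 = u ^ 4 + 4 * (q * (1 - q)) + 1"
      using V by (simp add: algebra_simps)
    \<comment> \<open>The four extra trials add at most 1 to the variance, and (4 / 3)^4 >
      3.\<close>
    also have "\<dots> \<le> (4 / 3 * u) ^ 4"
      using q1 u4 unfolding power_mult_distrib by (simp add: power_divide)
    finally show "real (m + 4) * q * (1 - q) + 1 \<le> (4 / 3 * u) ^ 4" .
  qed (use q u in auto)
  finally have *: "(\<Sum>j<m. sqrt_bern (m + 4) q (Suc j)) \<le> 7 * u"
    using u by simp
  have "(\<Sum>j<m. sqrt_bern m q j * (bern_ratio m q (Suc j) - bern_ratio m q j))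
      \<le> (\<Sum>j<m. 3 / ((real m + 1) * q * (1 - q)) * sqrt_bern (m + 4) q (Suc j))"
    using q by (intro sum_mono sqrt_bern_ratio_increment_le) auto
  also have "\<dots> = 3 / ((real m + 1) * q * (1 - q)) * (\<Sum>j<m. sqrt_bern (m + 4) q (Suc j))"
    by (simp add: sum_distrib_left)
  also have "\<dots> \<le> 3 / u ^ 4 * (7 * u)"
  proof (intro mult_mono * divide_left_mono)
    show "u ^ 4 \<le> (real m + 1) * q * (1 - q)"
      using V q by (simp add: algebra_simps)
  qed (use q u in \<open>auto intro!: sum_nonneg sqrt_bern_nonneg\<close>)
  also have "\<dots> = 21 / u ^ 3"
    using u by (simp add: power4_eq_xxxx power3_eq_cube)
  finally show ?thesis .
qed

lemma sqrt_bern_ends: "sqrt_bern m q 0 \<le> 2 / u ^ 3" "sqrt_bern m q m \<le> 2 / u ^ 3"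
proof -
  have "u ^ 4 \<le> m * (1 - (1 - q))" "u ^ 4 \<le> m * (1 - q)"
    using q unfolding V[symmetric] by (auto simp: mult_left_le mult_left_le_one_le mult.assoc intro!: mult_left_mono)
  then show "sqrt_bern m q 0 \<le> 2 / u ^ 3" "sqrt_bern m q m \<le> 2 / u ^ 3"
    using q u sqrt_power_le[of "1 - q" u m] sqrt_power_le[of q u m]
    by (auto simp: sqrt_bern_def Bernstein_def)
qed

lemma sqrt_bern_diff:
  assumes "j < m"
  shows "sqrt_bern m q (Suc j) - sqrt_bern m q j
    = sqrt_bern m q (Suc j) * (1 - bern_ratio m q (Suc j))"
  using sqrt_bern_pred[OF q assms] by (simp add: algebra_simps)

text \<open>Summation by parts turns this discrete Fisher information into the weighted variation of
  the likelihood ratio, so no moments of the binomial distribution beyond the second are needed.\<close>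

lemma fisher_le:
  "(\<Sum>j<m. (sqrt_bern m q (Suc j) - sqrt_bern m q j) * (1 - bern_ratio m q (Suc j))) \<le> 23 / u ^ 3"
proof -
  let ?b = "sqrt_bern m q" and ?t = "bern_ratio m q"
  have "(\<Sum>j<n. (?b (Suc j) - ?b j) * (1 - ?t (Suc j)))
      = ?b n * (1 - ?t n) - ?b 0 + (\<Sum>j<n. ?b j * (?t (Suc j) - ?t j))" for n
    by (induction n) (simp_all add: algebra_simps)
  then have "(\<Sum>j<m. (?b (Suc j) - ?b j) * (1 - ?t (Suc j)))
      = ?b m * (1 - ?t m) - ?b 0 + (\<Sum>j<m. ?b j * (?t (Suc j) - ?t j))" .
  also have "\<dots> \<le> ?b m + 21 / u ^ 3"
  proof -
    have "0 \<le> ?b 0" "0 \<le> ?b m" "0 \<le> ?t m"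
      using q by (auto intro!: sqrt_bern_nonneg simp: bern_ratio_def)
    moreover from this have "?b m * (1 - ?t m) \<le> ?b m"
      by (simp add: mult_left_le)
    ultimately show ?thesis
      using ratio_variation by linarith
  qed
  also have "\<dots> \<le> 2 / u ^ 3 + 21 / u ^ 3"
    using sqrt_bern_ends by simp
  finally show ?thesis
    by (simp flip: add_divide_distrib)
qed

text \<open>A difference is the square root at \<open>Suc j\<close> times one minus the ratio.
  Cauchy--Schwarz with that square root as density bounds the squared sum by the l^1 norm 6 * u
  times the Fisher sum 23 / u^3, and 6 * 23 = 138 <= 144.\<close>

lemma sqrt_bern_variation: "(\<Sum>j<m. \<bar>sqrt_bern m q (Suc j) - sqrt_bern m q j\<bar>) \<le> 12 / u"
proof (rule power2_le_imp_le)
  let ?b = "sqrt_bern m q" and ?t = "bern_ratio m q"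
  have b: "0 \<le> ?b j" for j
    using q by (intro sqrt_bern_nonneg) auto
  have "(\<Sum>j<m. \<bar>?b (Suc j) - ?b j\<bar>)\<^sup>2
      = (\<Sum>j<m. sqrt (?b (Suc j)) * (sqrt (?b (Suc j)) * \<bar>1 - ?t (Suc j)\<bar>))\<^sup>2"
    using b by (intro arg_cong[where f = "\<lambda>x. x\<^sup>2"] sum.cong)
      (auto simp: sqrt_bern_diff abs_mult simp flip: mult.assoc)
  also have "\<dots> \<le> (\<Sum>j<m. (sqrt (?b (Suc j)))\<^sup>2)
      * (\<Sum>j<m. (sqrt (?b (Suc j)) * \<bar>1 - ?t (Suc j)\<bar>)\<^sup>2)"
    by (rule Cauchy_Schwarz_ineq_sum)
  also have "(\<Sum>j<m. (sqrt (?b (Suc j)) * \<bar>1 - ?t (Suc j)\<bar>)\<^sup>2)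
      = (\<Sum>j<m. (?b (Suc j) - ?b j) * (1 - ?t (Suc j)))"
    using b by (intro sum.cong)
      (simp_all add: power_mult_distrib sqrt_bern_diff, simp add: power2_eq_square)
  also have "(\<Sum>j<m. (sqrt (?b (Suc j)))\<^sup>2) = (\<Sum>j\<in>{1..<Suc m}. ?b j)"
    using b by (simp add: sum.shift_bounds_Suc_ivl lessThan_atLeast0 del: sum.op_ivl_Suc)
  also have "(\<Sum>j\<in>{1..<Suc m}. ?b j) * (\<Sum>j<m. (?b (Suc j) - ?b j) * (1 - ?t (Suc j)))
      \<le> (6 * u) * (23 / u ^ 3)"
  proof (rule mult_mono)
    have "(\<Sum>j\<in>{1..<Suc m}. ?b j) \<le> (\<Sum>j\<le>m. ?b j)"
      using b by (intro sum_mono2) auto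
    then show "(\<Sum>j\<in>{1..<Suc m}. ?b j) \<le> 6 * u"
      using sum_sqrt_bern_le_6[of q u m] q u V by simp
    show "0 \<le> (\<Sum>j<m. (?b (Suc j) - ?b j) * (1 - ?t (Suc j)))"
      using b by (intro sum_nonneg) (auto simp: sqrt_bern_diff mult.assoc)
  qed (use fisher_le u in auto)
  also have "\<dots> \<le> (12 / u)\<^sup>2"
    using u by (simp add: power_divide power2_eq_square power3_eq_cube field_simps)
  finally show "(\<Sum>j<m. \<bar>?b (Suc j) - ?b j\<bar>)\<^sup>2 \<le> (12 / u)\<^sup>2" .
qed (use u in simp)

lemma scale_sq_le: "u\<^sup>2 \<le> m" "0 < m"
proof -
  have "u\<^sup>2 \<le> u ^ 4"
    using u by (intro power_increasing) auto
  also have "u ^ 4 \<le> real m * 1"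
    unfolding V[symmetric] mult.assoc using q by (intro mult_left_mono) (auto intro: mult_le_one)
  finally show "u\<^sup>2 \<le> m"
    by simp
  then show "0 < m"
    using u one_le_power[of u 2] by (cases m) auto
qed

end

section \<open>Rudin--Shapiro polynomials with binomial weights\<close>

definition rs_poly :: "nat \<Rightarrow> real \<Rightarrow> complex \<Rightarrow> complex" where
  "rs_poly m q w = (\<Sum>j\<le>m. of_real (rudin_shapiro j) * w ^ j * of_real (sqrt_bern m q j))"

lemma atMost_eq_ivl: "{..m} = {0..<Suc m}"
  by (simp add: atLeast0LessThan lessThan_Suc_atMost)

lemma norm_rs_term: "norm w = 1 \<Longrightarrow> norm (of_real (rudin_shapiro j) * w ^ j * v) = norm v"
  for w v :: complex
  by (simp add: norm_mult norm_power)

text \<open>For variance below 1 the l^1 norm is already bounded. Otherwise blocks of length u^2,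
  the standard deviation, balance l^1 norm and variation: 72 * (6 + 12) = 1296.\<close>

lemma norm_rs_poly_le:
  assumes w: "norm w = 1" and q: "0 \<le> q" "q \<le> 1"
  shows "norm (rs_poly m q w) \<le> 1300"
proof -
  define V where "V = m * q * (1 - q)"
  show ?thesis
  proof (cases "V \<ge> 1")
    case False
    have "norm (rs_poly m q w) \<le> (\<Sum>j\<le>m. sqrt_bern m q j)"
      unfolding rs_poly_def using q
      by (intro sum_norm_le) (simp add: norm_rs_term[OF w] sqrt_bern_nonneg)
    also have "\<dots> \<le> 6"
      using sum_sqrt_bern_le_6[of q 1 m] q False by (simp add: V_def)
    finally show ?thesis
      by simp
  next
    case True
    define u where "u = root 4 V"
    have u: "1 \<le> u" "m * q * (1 - q) = u ^ 4"
      using True by (auto simp: u_def V_def)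
    have q': "0 < q" "q < 1"
      using q True unfolding V_def by (metis less_eq_real_def mult_zero_left mult_zero_right
          not_one_le_zero diff_self)+
    have "norm (rs_poly m q w) \<le> 72 * ((\<Sum>j<Suc m. norm (complex_of_real (sqrt_bern m q j))) / u
        + u * (\<Sum>j<Suc m - 1. norm (complex_of_real (sqrt_bern m q (Suc j)) - of_real (sqrt_bern m q j))))"
      unfolding rs_poly_def atMost_eq_ivl
      using scale_sq_le[OF q' u] by (intro norm_rs_weighted_sum_scale w u(1)) auto
    also have "\<dots> = 72 * ((\<Sum>j\<le>m. sqrt_bern m q j) / u
        + u * (\<Sum>j<m. \<bar>sqrt_bern m q (Suc j) - sqrt_bern m q j\<bar>))"
      using q by (simp add: lessThan_Suc_atMost sqrt_bern_nonneg flip: of_real_diff)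
    also have "\<dots> \<le> 72 * (6 * u / u + u * (12 / u))"
      using u sum_sqrt_bern_le_6[of q u m] sqrt_bern_variation[OF q' u] q
      by (intro mult_left_mono add_mono divide_right_mono) auto
    also have "\<dots> \<le> 1300"
      using u by simp
    finally show ?thesis .
  qed
qed

lemma abs_sqrt_add_sq_diff_le:
  fixes a s t :: real
  shows "\<bar>sqrt (a\<^sup>2 + s\<^sup>2) - sqrt (a\<^sup>2 + t\<^sup>2)\<bar> \<le> \<bar>s - t\<bar>"
  using norm_triangle_ineq3[of "Complex a s" "Complex a t"]
  by (simp add: complex_norm complex_diff)

section \<open>The effect of one more trial\<close>

lemma Bernstein_Suc:
  "Bernstein (Suc m) (Suc j) q = (1 - q) * Bernstein m (Suc j) q + q * Bernstein m j q"
proof (cases "j < m")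
  case True
  then show ?thesis
    by (simp add: Bernstein_def Suc_diff_Suc[symmetric] algebra_simps)
next
  case False
  then consider "j = m" | "m < j"
    by linarith
  then show ?thesis
    by cases (simp_all add: Bernstein_def binomial_eq_0)
qed

text \<open>By the recursion the new square root is the norm of the plane vector with entries sqrt
  (1 - q) * x and sqrt q * y, where x and y are the old square roots at \<open>Suc j\<close> and
  \<open>j\<close>. Replacing y by x gives norm exactly x, and this moves the vector by sqrt q * |x
  - y|.\<close>

lemma sqrt_bern_Suc_diff_le:
  assumes q: "0 \<le> q" "q \<le> 1"
  shows "\<bar>sqrt_bern (Suc m) q (Suc j) - sqrt_bern m q (Suc j)\<bar>
      \<le> sqrt q * \<bar>sqrt_bern m q (Suc j) - sqrt_bern m q j\<bar>"
    and "\<bar>sqrt_bern (Suc m) q 0 - sqrt_bern m q 0\<bar> \<le> sqrt q * sqrt_bern m q 0"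
proof -
  have *: "\<bar>sqrt ((1 - q) * x\<^sup>2 + q * y\<^sup>2) - x\<bar> \<le> sqrt q * \<bar>x - y\<bar>" if "0 \<le> x" for x y
  proof -
    have "sqrt ((1 - q) * x\<^sup>2 + q * x\<^sup>2) = x"
      using that by (simp flip: distrib_right)
    then show ?thesis
      using abs_sqrt_add_sq_diff_le[of "sqrt (1 - q) * x" "sqrt q * y" "sqrt q * x"] q
      by (simp add: power_mult_distrib abs_mult abs_minus_commute flip: right_diff_distrib)
  qed
  show "\<bar>sqrt_bern (Suc m) q (Suc j) - sqrt_bern m q (Suc j)\<bar>
      \<le> sqrt q * \<bar>sqrt_bern m q (Suc j) - sqrt_bern m q j\<bar>"
    using *[of "sqrt_bern m q (Suc j)" "sqrt_bern m q j"] q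
    by (simp add: sqrt_bern_sq sqrt_bern_nonneg)
      (simp add: sqrt_bern_def Bernstein_Suc)
  have "Bernstein (Suc m) 0 q = (1 - q) * Bernstein m 0 q"
    by (simp add: Bernstein_def)
  then show "\<bar>sqrt_bern (Suc m) q 0 - sqrt_bern m q 0\<bar> \<le> sqrt q * sqrt_bern m q 0"
    using *[of "sqrt_bern m q 0" 0] q
    by (simp add: sqrt_bern_sq sqrt_bern_nonneg) (simp add: sqrt_bern_def)
qed

lemma sum_abs_sqrt_bern_Suc_diff:
  assumes q: "0 \<le> q" "q \<le> 1"
  shows "(\<Sum>j\<le>m. \<bar>sqrt_bern (Suc m) q j - sqrt_bern m q j\<bar>)
    \<le> sqrt q * (sqrt_bern m q 0 + (\<Sum>j<m. \<bar>sqrt_bern m q (Suc j) - sqrt_bern m q j\<bar>))"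
proof -
  have "(\<Sum>j\<le>m. \<bar>sqrt_bern (Suc m) q j - sqrt_bern m q j\<bar>)
      = \<bar>sqrt_bern (Suc m) q 0 - sqrt_bern m q 0\<bar>
        + (\<Sum>j<m. \<bar>sqrt_bern (Suc m) q (Suc j) - sqrt_bern m q (Suc j)\<bar>)"
    by (rule sum.atMost_shift)
  also have "\<dots> \<le> sqrt q * sqrt_bern m q 0
      + (\<Sum>j<m. sqrt q * \<bar>sqrt_bern m q (Suc j) - sqrt_bern m q j\<bar>)"
    by (intro add_mono sum_mono sqrt_bern_Suc_diff_le q)
  finally show ?thesis
    by (simp add: sum_distrib_left distrib_left)
qed

text \<open>The change is the old square root times h (t), with t the likelihood ratio and h (t) =
  sqrt (1 - q + q * t^2) - 1. As h is Lipschitz with constant sqrt q and vanishes at t = 1, the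
  product rule leaves only the Fisher sum and the variation of the ratios: 23 + 21 = 44.\<close>

lemma sqrt_bern_Suc_variation:
  assumes q: "0 < q" "q < 1" and u: "1 \<le> u" and V: "m * q * (1 - q) = u ^ 4"
  defines "v \<equiv> \<lambda>j. sqrt_bern (Suc m) q j - sqrt_bern m q j"
  shows "(\<Sum>j<m. \<bar>v (Suc j) - v j\<bar>) \<le> sqrt q * (44 / u ^ 3)"
proof -
  let ?b = "sqrt_bern m q" and ?t = "bern_ratio m q"
  define h where "h t = sqrt ((1 - q) + q * t\<^sup>2) - 1" for t
  have b: "0 \<le> ?b j" for j
    using q by (intro sqrt_bern_nonneg) auto
  have t: "0 \<le> ?t j" if "j \<le> m" for j
    using q that by (auto simp: bern_ratio_def)
  have h: "\<bar>h s - h t\<bar> \<le> sqrt q * \<bar>s - t\<bar>" for s t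
    using abs_sqrt_add_sq_diff_le[of "sqrt (1 - q)" "sqrt q * s" "sqrt q * t"] q
    by (simp add: h_def power_mult_distrib abs_mult flip: right_diff_distrib)
  have v: "v j = ?b j * h (?t j)" if "j \<le> m" for j
  proof -
    have "Bernstein (Suc m) j q = Bernstein m j q * ((1 - q) + q * (?t j)\<^sup>2)"
    proof (cases j)
      case 0
      then show ?thesis
        by (simp add: Bernstein_def)
    next
      case (Suc i)
      then have "?b i = ?b j * ?t j"
        using sqrt_bern_pred[OF q] that by simp
      then have "(?b i)\<^sup>2 = (?b j)\<^sup>2 * (?t j)\<^sup>2"
        by (simp add: power_mult_distrib)
      then have "Bernstein m i q = Bernstein m j q * (?t j)\<^sup>2"
        using q by (simp add: sqrt_bern_sq)
      then show ?thesis
        by (simp add: Suc Bernstein_Suc algebra_simps)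
    qed
    then show ?thesis
      by (simp add: v_def h_def sqrt_bern_def real_sqrt_mult right_diff_distrib)
  qed
  have "(\<Sum>j<m. \<bar>v (Suc j) - v j\<bar>)
      \<le> (\<Sum>j<m. sqrt q * ((?b (Suc j) - ?b j) * (1 - ?t (Suc j)) + ?b j * (?t (Suc j) - ?t j)))"
  proof (rule sum_mono)
    fix j assume "j \<in> {..<m}"
    then have j: "j < m"
      by simp
    have h1: "h 1 = 0"
      by (simp add: h_def)
    have "v (Suc j) - v j
        = (?b (Suc j) - ?b j) * (h (?t (Suc j)) - h 1) + ?b j * (h (?t (Suc j)) - h (?t j))"
      using j by (simp add: v h1 algebra_simps)
    also have "\<bar>\<dots>\<bar> \<le> \<bar>?b (Suc j) - ?b j\<bar> * (sqrt q * \<bar>?t (Suc j) - 1\<bar>)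
        + ?b j * (sqrt q * \<bar>?t (Suc j) - ?t j\<bar>)"
      using b by (intro abs_triangle_ineq[THEN order_trans] add_mono)
        (auto simp: abs_mult intro!: mult_left_mono h)
    also have "\<bar>?b (Suc j) - ?b j\<bar> * (sqrt q * \<bar>?t (Suc j) - 1\<bar>)
        = sqrt q * ((?b (Suc j) - ?b j) * (1 - ?t (Suc j)))"
      using b[of "Suc j"] by (simp add: sqrt_bern_diff[OF q u V j] abs_mult abs_minus_commute)
    also have "\<bar>?t (Suc j) - ?t j\<bar> = ?t (Suc j) - ?t j"
      using bern_ratio_mono[OF q j] by simp
    finally show "\<bar>v (Suc j) - v j\<bar>
        \<le> sqrt q * ((?b (Suc j) - ?b j) * (1 - ?t (Suc j)) + ?b j * (?t (Suc j) - ?t j))"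
      by (simp add: algebra_simps)
  qed
  also have "\<dots> = sqrt q * ((\<Sum>j<m. (?b (Suc j) - ?b j) * (1 - ?t (Suc j)))
      + (\<Sum>j<m. ?b j * (?t (Suc j) - ?t j)))"
    by (simp only: sum.distrib flip: sum_distrib_left)
  also have "\<dots> \<le> sqrt q * (23 / u ^ 3 + 21 / u ^ 3)"
    using fisher_le[OF q u V] ratio_variation[OF q u V] q
    by (intro mult_left_mono add_mono) auto
  finally show ?thesis
    by (simp flip: add_divide_distrib)
qed

text \<open>The change of the weights has l^1 norm of order sqrt q / u and variation of order sqrt q
  / u^3, both smaller by sqrt q / u^2 than for the weights themselves. Abel summation thus gives
  sqrt q / u^2 = 1 / sqrt (m * (1 - q)), and the factor sqrt (1 - q) makes this uniform in
  \<open>q\<close>.\<close>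

lemma norm_rs_poly_Suc_diff_le:
  assumes w: "norm w = 1" and q: "0 \<le> q" "q \<le> 1"
  shows "sqrt (1 - q) * norm (rs_poly (Suc m) q w - rs_poly m q w) \<le> 8400 / sqrt (Suc m)"
proof -
  define v where "v j = sqrt_bern (Suc m) q j - sqrt_bern m q j" for j
  define T where "T = (\<Sum>j\<le>m. of_real (rudin_shapiro j) * w ^ j * complex_of_real (v j))"
  define e where "e = of_real (rudin_shapiro (Suc m)) * w ^ Suc m * complex_of_real (v (Suc m))"
  define V where "V = m * q * (1 - q)"
  have q4: "q * (1 - q) \<le> 1 / 4"
    using zero_le_power2[of "q - 1 / 2"] by (simp add: power2_eq_square algebra_simps)
  have "rs_poly (Suc m) q w - rs_poly m q w = T + e"
    by (simp add: rs_poly_def T_def e_def v_def sqrt_bern_eq_0 sum_subtractf algebra_simps)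
  then have "norm (rs_poly (Suc m) q w - rs_poly m q w) \<le> norm T + norm e"
    by (simp add: norm_triangle_ineq)
  then have "sqrt (1 - q) * norm (rs_poly (Suc m) q w - rs_poly m q w)
      \<le> sqrt (1 - q) * norm T + sqrt (1 - q) * norm e"
    using q by (simp add: mult_left_mono flip: distrib_left)
  also have "sqrt (1 - q) * norm e \<le> 1 / sqrt (Suc m)"
  proof -
    have "norm e = sqrt (q ^ Suc m)"
      unfolding e_def norm_rs_term[OF w]
      using q by (simp add: v_def sqrt_bern_eq_0 sqrt_bern_nonneg)
        (simp add: sqrt_bern_def Bernstein_def)
    \<comment> \<open>The top term occurs for \<open>Suc m\<close> trials only. With y = Suc m * (1
      - q) it is controlled by y * exp (- y) <= 1.\<close>
    moreover have "(1 - q) * q ^ Suc m \<le> 1 / Suc m"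
    proof -
      define y where "y = Suc m * (1 - q)"
      have "y * q ^ Suc m \<le> y * exp (- y)"
        using power_le_exp_complement[OF q(1), of "Suc m"] q
        by (intro mult_left_mono) (auto simp: y_def)
      also have "\<dots> \<le> exp y * exp (- y)"
      proof (rule mult_right_mono)
        show "y \<le> exp y"
          using exp_ge_add_one_self[of y] by linarith
      qed simp
      also have "\<dots> = 1"
        by (simp flip: exp_add)
      finally show ?thesis
        by (simp add: y_def field_simps)
    qed
    then have "sqrt ((1 - q) * q ^ Suc m) \<le> sqrt (1 / Suc m)"
      by (rule real_sqrt_le_mono)
    ultimately show ?thesis
      by (simp only: real_sqrt_mult real_sqrt_divide real_sqrt_one)
  qed
  also have "sqrt (1 - q) * norm T \<le> 8352 / sqrt (Suc m)"
  proof (cases "V \<ge> 1")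
    case False
    have "norm T \<le> (\<Sum>j\<le>m. \<bar>v j\<bar>)"
      unfolding T_def by (intro sum_norm_le) (simp add: norm_rs_term[OF w])
    also have "\<dots> \<le> sqrt q * (sqrt_bern m q 0 + (\<Sum>j<m. \<bar>sqrt_bern m q (Suc j) - sqrt_bern m q j\<bar>))"
      unfolding v_def by (rule sum_abs_sqrt_bern_Suc_diff[OF q])
    also have "\<dots> \<le> sqrt q * (6 + (6 + 6))"
    proof -
      have S: "(\<Sum>j\<le>m. sqrt_bern m q j) \<le> 6"
        using sum_sqrt_bern_le_6[of q 1 m] q False by (simp add: V_def)
      have b: "0 \<le> sqrt_bern m q j" for j
        using q by (rule sqrt_bern_nonneg)
      have "sqrt_bern m q 0 \<le> (\<Sum>j\<le>m. sqrt_bern m q j)"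
        using b by (intro member_le_sum) auto
      moreover have "(\<Sum>j<m. \<bar>sqrt_bern m q (Suc j) - sqrt_bern m q j\<bar>)
          \<le> (\<Sum>j<m. sqrt_bern m q (Suc j) + sqrt_bern m q j)"
        using b by (intro sum_mono) (smt (verit))
      moreover have "(\<Sum>j<m. sqrt_bern m q (Suc j)) \<le> (\<Sum>j\<le>m. sqrt_bern m q j)"
        using b[of 0] by (simp add: sum.atMost_shift)
      moreover have "(\<Sum>j<m. sqrt_bern m q j) \<le> (\<Sum>j\<le>m. sqrt_bern m q j)"
        using b by (intro sum_mono2) auto
      ultimately show ?thesis
        using S q by (intro mult_left_mono) (auto simp: sum.distrib)
    qed
    finally have "sqrt (1 - q) * norm T \<le> sqrt (1 - q) * (sqrt q * 18)"
      using q by (intro mult_left_mono) auto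
    also have "\<dots> = 18 * sqrt (q * (1 - q))"
      by (simp add: real_sqrt_mult)
    also have "\<dots> \<le> 18 * sqrt (4 / Suc m)"
    proof -
      \<comment> \<open>Small variance makes sqrt (q * (1 - q)) itself of order 1 / sqrt (Suc m), so
        the l^1 estimate is enough without cancellation.\<close>
      have "q * (1 - q) * Suc m \<le> 4"
        using False q4 by (simp add: V_def algebra_simps)
      then show ?thesis
        by (simp add: pos_le_divide_eq del: of_nat_Suc)
    qed
    also have "\<dots> \<le> 8352 / sqrt (Suc m)"
      by (simp add: real_sqrt_divide divide_right_mono del: of_nat_Suc)
    finally show ?thesis .
  next
    case True
    define u where "u = root 4 V"
    have u: "1 \<le> u" "m * q * (1 - q) = u ^ 4"
      using True by (auto simp: u_def V_def)
    have q': "0 < q" "q < 1"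
      using q True unfolding V_def by (metis less_eq_real_def mult_zero_left mult_zero_right
          not_one_le_zero diff_self)+
    have m: "0 < m"
      by (rule scale_sq_le[OF q' u])
    have "norm T \<le> 72 * ((\<Sum>j<Suc m. norm (complex_of_real (v j))) / u
        + u * (\<Sum>j<Suc m - 1. norm (complex_of_real (v (Suc j)) - of_real (v j))))"
      unfolding T_def atMost_eq_ivl
      using scale_sq_le[OF q' u] by (intro norm_rs_weighted_sum_scale w u(1)) auto
    also have "\<dots> = 72 * ((\<Sum>j\<le>m. \<bar>v j\<bar>) / u + u * (\<Sum>j<m. \<bar>v (Suc j) - v j\<bar>))"
      by (simp add: lessThan_Suc_atMost flip: of_real_diff)
    also have "\<dots> \<le> 72 * ((sqrt q * (14 / u)) / u + u * (sqrt q * (44 / u ^ 3)))"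
    proof -
      have "u \<le> u ^ 3"
        using u(1) power_increasing[of 1 3 u] by simp
      then have "2 / u ^ 3 \<le> 2 / u"
        using u by (intro divide_left_mono) auto
      then have "sqrt_bern m q 0 \<le> 2 / u"
        using sqrt_bern_ends(1)[OF q' u] by linarith
      then have "sqrt_bern m q 0 + (\<Sum>j<m. \<bar>sqrt_bern m q (Suc j) - sqrt_bern m q j\<bar>) \<le> 2 / u + 12 / u"
        using sqrt_bern_variation[OF q' u] by (rule add_mono)
      then have "sqrt q * (sqrt_bern m q 0 + (\<Sum>j<m. \<bar>sqrt_bern m q (Suc j) - sqrt_bern m q j\<bar>))
          \<le> sqrt q * (14 / u)"
        using q by (intro mult_left_mono) (auto simp flip: add_divide_distrib)
      then have "(\<Sum>j\<le>m. \<bar>v j\<bar>) \<le> sqrt q * (14 / u)"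
        using sum_abs_sqrt_bern_Suc_diff[OF q, of m] unfolding v_def by linarith
      then show ?thesis
        using sqrt_bern_Suc_variation[OF q' u] u(1) unfolding v_def
        by (intro mult_left_mono add_mono divide_right_mono) auto
    qed
    also have "\<dots> = 4176 * (sqrt q / u\<^sup>2)"
      using u by (simp add: power2_eq_square power3_eq_cube field_simps)
    also have "u\<^sup>2 = sqrt (m * q * (1 - q))"
      unfolding u(2) by (rule real_sqrt_unique[symmetric]) (simp_all flip: power_mult)
    finally have "sqrt (1 - q) * norm T
        \<le> sqrt (1 - q) * (4176 * (sqrt q / sqrt (m * q * (1 - q))))"
      using q by (intro mult_left_mono) auto
    also have "\<dots> = 4176 / sqrt m"
      using q' m by (simp add: real_sqrt_mult)
    also have "\<dots> \<le> 4176 * (2 / sqrt (Suc m))"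
    proof -
      have "sqrt (Suc m) \<le> sqrt (4 * m)"
        using m by (intro real_sqrt_le_mono) auto
      then show ?thesis
        using m by (simp add: real_sqrt_mult field_simps)
    qed
    finally show ?thesis
      by simp
  qed
  also have "8352 / sqrt (Suc m) + 1 / sqrt (Suc m) \<le> 8400 / sqrt (Suc m)"
    unfolding add_divide_distrib[symmetric] by (intro divide_right_mono) auto
  finally show ?thesis
    by simp
qed


text \<open>Dividing a binomial weight by N + 1 - j gives the weight with one more failure, up to
  the factor (N + 1) * (1 - p); the 2 compares N - 1 - j with N + 1 - j. Thus increments of size 1 /
  sqrt (N - 1 - j) in the inner sums still lead to an l^1 sum of square roots.\<close>

lemma sqrt_bern_div_sqrt_le:
  fixes p :: real
  assumes p: "0 \<le> p" "p < 1" and j: "Suc j < N"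
  shows "sqrt_bern N p j / sqrt (real (N - 1 - j)) \<le> 2 / sqrt (Suc N * (1 - p)) * sqrt_bern (Suc N) p j"
proof -
  obtain d where N: "N = j + d + 2"
    using j less_imp_Suc_add[OF j] by auto
  have "real (Suc N choose j) * (real d + 3) = real (N choose j) * Suc N"
  proof -
    have "Suc N * (N choose j) = (Suc N - j) * (Suc N choose j)"
      using binomial_absorb_comp[of "Suc N" j] by (simp add: mult.commute)
    moreover have "Suc N - j = d + 3"
      by (simp add: N)
    ultimately show ?thesis
      by (metis (no_types, lifting) mult.commute of_nat_add of_nat_mult of_nat_numeral)
  qed
  moreover define A B where "A = real (N choose j)" and "B = real (Suc N choose j)"
  ultimately have B: "B = A * Suc N / (real d + 3)"
    by (simp add: field_simps)
  define K where "K = A * p ^ j * (1 - p) ^ (d + 2)"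
  have K: "0 \<le> K"
    using p by (simp add: K_def A_def)
  have "Bernstein N j p / (real d + 1) = K / (real d + 1)"
    by (simp add: Bernstein_def K_def A_def N)
  also have "\<dots> \<le> K / ((real d + 3) / 4)"
    using K by (intro divide_left_mono) auto
  also have "\<dots> = 4 / (Suc N * (1 - p)) * Bernstein (Suc N) j p"
  proof -
    have "Suc N - j = Suc (d + 2)"
      by (simp add: N)
    then have "Bernstein (Suc N) j p = K * (1 - p) * (Suc N / (real d + 3))"
      unfolding Bernstein_def B_def[symmetric] B K_def by (simp del: of_nat_Suc)
    then show ?thesis
      using p by (simp del: of_nat_Suc)
  qed
  finally have "sqrt (Bernstein N j p / (real d + 1))
      \<le> sqrt (4 / (Suc N * (1 - p)) * Bernstein (Suc N) j p)"
    by (rule real_sqrt_le_mono)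
  moreover have "real (N - 1 - j) = real d + 1"
    by (simp add: N)
  ultimately show ?thesis
    by (simp only: sqrt_bern_def real_sqrt_mult real_sqrt_divide real_sqrt_four)
qed

text \<open>Abel summation in the row index, with the inner sum as part of the slowly varying
  weight. The product rule splits a difference into the variation of the binomial square roots and
  the increment of the inner sums. The condition d <= N keeps out row N, where N - 1 - j would be
  truncated. The constant is 72 * (1300 * 6 + 1300 * 12 + 16800 * 7).\<close>

lemma norm_rs_row_sum_le:
  assumes z: "norm z = 1" and w: "norm w = 1" and p: "0 \<le> p" "p \<le> 1" and q: "0 \<le> q" "q \<le> 1"
    and d: "d \<le> N"
  shows "norm (\<Sum>j\<in>{c..<d}. of_real (rudin_shapiro j) * z ^ j
      * (of_real (sqrt_bern N p j) * (of_real (sqrt (1 - q)) * rs_poly (N - 1 - j) q w))) \<le> 10152000"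
    (is "norm (\<Sum>j\<in>_. _ * ?G j) \<le> _")
proof -
  let ?b = "sqrt_bern N p"
  define g where "g j = of_real (sqrt (1 - q)) * rs_poly (N - 1 - j) q w" for j
  define V where "V = N * p * (1 - p)"
  have b: "0 \<le> ?b j" for j
    using p by (rule sqrt_bern_nonneg)
  have g: "norm (g j) \<le> 1300" for j
  proof -
    have "norm (g j) = sqrt (1 - q) * norm (rs_poly (N - 1 - j) q w)"
      using q by (simp add: g_def norm_mult)
    also have "\<dots> \<le> 1 * 1300"
      using q by (intro mult_mono norm_rs_poly_le w) auto
    finally show ?thesis
      by simp
  qed
  have G: "norm (?G j) \<le> 1300 * ?b j" for j
    using mult_left_mono[OF g b, of j j] b[of j] by (simp add: norm_mult g_def mult_ac)
  have sub: "(\<Sum>j\<in>A. 1300 * ?b j) \<le> 1300 * (\<Sum>j\<le>N. ?b j)" if "A \<subseteq> {..N}" for A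
    using that b unfolding sum_distrib_left by (intro sum_mono2) auto
  show ?thesis
  proof (cases "V \<ge> 1")
    case False
    have "norm (\<Sum>j\<in>{c..<d}. of_real (rudin_shapiro j) * z ^ j * ?G j) \<le> (\<Sum>j\<in>{c..<d}. 1300 * ?b j)"
      by (intro sum_norm_le) (simp only: norm_rs_term[OF z] G)
    also have "\<dots> \<le> 1300 * (\<Sum>j\<le>N. ?b j)"
      using d by (intro sub) auto
    also have "\<dots> \<le> 1300 * 6"
      using sum_sqrt_bern_le_6[of p 1 N] p False by (simp add: V_def)
    finally show ?thesis
      by simp
  next
    case True
    define u where "u = root 4 V"
    have u: "1 \<le> u" "N * p * (1 - p) = u ^ 4"
      using True by (auto simp: u_def V_def)
    have p': "0 < p" "p < 1"
      using p True unfolding V_def by (metis less_eq_real_def mult_zero_left mult_zero_right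
          not_one_le_zero diff_self)+
    have "norm (\<Sum>j\<in>{c..<d}. of_real (rudin_shapiro j) * z ^ j * ?G j)
        \<le> 72 * ((\<Sum>j<N. norm (?G j)) / u + u * (\<Sum>j<N - 1. norm (?G (Suc j) - ?G j)))"
      using scale_sq_le[OF p' u] d by (intro norm_rs_weighted_sum_scale z u(1)) auto
    also have "\<dots> \<le> 72 * (1300 * (6 * u) / u + u * (15600 / u + 117600 / u))"
    proof -
      have "(\<Sum>j<N. norm (?G j)) \<le> (\<Sum>j<N. 1300 * ?b j)"
        by (intro sum_mono G)
      also have "\<dots> \<le> 1300 * (\<Sum>j\<le>N. ?b j)"
        by (intro sub) auto
      also have "\<dots> \<le> 1300 * (6 * u)"
        using sum_sqrt_bern_le_6[of p u N] p u by simp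
      finally have 1: "(\<Sum>j<N. norm (?G j)) \<le> 1300 * (6 * u)" .
      have "(\<Sum>j<N - 1. norm (?G (Suc j) - ?G j))
          \<le> (\<Sum>j<N - 1. 1300 * \<bar>?b (Suc j) - ?b j\<bar>
              + 16800 / sqrt (Suc N * (1 - p)) * sqrt_bern (Suc N) p j)"
      proof (rule sum_mono)
        fix j assume "j \<in> {..<N - 1}"
        then have j: "Suc j < N"
          by auto
        have "?G (Suc j) - ?G j = of_real (?b (Suc j) - ?b j) * g (Suc j) + of_real (?b j) * (g (Suc j) - g j)"
          unfolding g_def[symmetric] by (simp add: algebra_simps)
        also have "norm \<dots> \<le> \<bar>?b (Suc j) - ?b j\<bar> * norm (g (Suc j)) + ?b j * norm (g (Suc j) - g j)"
          using b[of j] norm_triangle_ineq[of "of_real (?b (Suc j) - ?b j) * g (Suc j)"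
              "of_real (?b j) * (g (Suc j) - g j)"]
          unfolding norm_mult norm_of_real by simp
        also have "\<dots> \<le> \<bar>?b (Suc j) - ?b j\<bar> * 1300 + ?b j * (8400 / sqrt (real (N - 1 - j)))"
        proof (intro add_mono mult_left_mono g b)
          \<comment> \<open>The inner sum of row \<open>j\<close> has \<open>Suc m\<close> trials
            and that of row \<open>Suc j\<close> has \<open>m\<close>, so neighbouring rows differ
            by one trial.\<close>
          obtain m where m: "N = Suc (Suc (j + m))"
            using less_imp_Suc_add[OF j] by auto
          have "norm (g (Suc j) - g j)
              = sqrt (1 - q) * norm (rs_poly (Suc m) q w - rs_poly m q w)"
            using q by (simp add: g_def m norm_mult norm_minus_commute flip: right_diff_distrib)
          also have "\<dots> \<le> 8400 / sqrt (Suc m)"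
            by (rule norm_rs_poly_Suc_diff_le[OF w q])
          finally show "norm (g (Suc j) - g j) \<le> 8400 / sqrt (real (N - 1 - j))"
            by (simp add: m)
        qed auto
        also have "?b j * (8400 / sqrt (real (N - 1 - j))) = 8400 * (?b j / sqrt (real (N - 1 - j)))"
          by simp
        also have "\<dots> \<le> 8400 * (2 / sqrt (Suc N * (1 - p)) * sqrt_bern (Suc N) p j)"
          using p' by (intro mult_left_mono sqrt_bern_div_sqrt_le j) auto
        finally show "norm (?G (Suc j) - ?G j) \<le> 1300 * \<bar>?b (Suc j) - ?b j\<bar>
            + 16800 / sqrt (Suc N * (1 - p)) * sqrt_bern (Suc N) p j"
          by (simp add: mult_ac)
      qed
      also have "\<dots> = 1300 * (\<Sum>j<N - 1. \<bar>?b (Suc j) - ?b j\<bar>)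
          + 16800 / sqrt (Suc N * (1 - p)) * (\<Sum>j<N - 1. sqrt_bern (Suc N) p j)"
        by (simp only: sum.distrib flip: sum_distrib_left)
      also have "\<dots> \<le> 1300 * (12 / u) + 16800 / u\<^sup>2 * (7 * u)"
      proof (intro add_mono mult_left_mono mult_mono)
        have "(\<Sum>j<N - 1. \<bar>?b (Suc j) - ?b j\<bar>) \<le> (\<Sum>j<N. \<bar>?b (Suc j) - ?b j\<bar>)"
          by (intro sum_mono2) auto
        then show "(\<Sum>j<N - 1. \<bar>?b (Suc j) - ?b j\<bar>) \<le> 12 / u"
          using sqrt_bern_variation[OF p' u] by linarith
        have p4: "p * (1 - p) \<le> 1 / 4"
          using zero_le_power2[of "p - 1 / 2"] by (simp add: power2_eq_square algebra_simps)
        have "(\<Sum>j<N - 1. sqrt_bern (Suc N) p j) \<le> (\<Sum>j\<le>Suc N. sqrt_bern (Suc N) p j)"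
          using p by (intro sum_mono2 sqrt_bern_nonneg) auto
        also have "\<dots> \<le> 5 * (4 / 3 * u)"
        proof (rule sum_sqrt_bern_le)
          have "real (Suc N) * p * (1 - p) + 1 = u ^ 4 + p * (1 - p) + 1"
            using u(2) by (simp add: algebra_simps)
          also have "\<dots> \<le> (4 / 3 * u) ^ 4"
            using p4 one_le_power[OF u(1), of 4] unfolding power_mult_distrib power_divide by simp
          finally show "real (Suc N) * p * (1 - p) + 1 \<le> (4 / 3 * u) ^ 4" .
        qed (use p u in auto)
        finally show "(\<Sum>j<N - 1. sqrt_bern (Suc N) p j) \<le> 7 * u"
          using u by simp
        have "u\<^sup>2 = sqrt (N * p * (1 - p))"
          unfolding u(2) by (rule real_sqrt_unique[symmetric]) (simp_all flip: power_mult)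
        also have "\<dots> \<le> sqrt (Suc N * (1 - p))"
          using p by (intro real_sqrt_le_mono mult_right_mono) (auto simp: mult_left_le add_increasing)
        finally show "16800 / sqrt (Suc N * (1 - p)) \<le> 16800 / u\<^sup>2"
          using u p' by (intro divide_left_mono mult_pos_pos) auto
      qed (use u p in \<open>auto intro!: sum_nonneg sqrt_bern_nonneg\<close>)
      also have "\<dots> = 15600 / u + 117600 / u"
        using u by (simp add: power2_eq_square)
      finally show ?thesis
        using 1 u by (intro mult_left_mono add_mono divide_right_mono) auto
    qed
    also have "\<dots> = 10152000"
      using u by (simp add: field_simps)
    finally show ?thesis .
  qed
qed

section \<open>Rotation invariance of the sphere measure\<close>

lemma emeasure_lborel_ball_shift:
  fixes x y :: "'a::euclidean_space"
  shows "emeasure lborel (ball x r) = emeasure lborel (ball y r)"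
proof -
  have "emeasure lborel (ball x r) = emeasure (distr lborel borel ((+) (x - y))) (ball x r)"
    by (simp only: lborel_distr_plus)
  also have "\<dots> = emeasure lborel ((+) (x - y) -` ball x r)"
    by (subst emeasure_distr) auto
  also have "(+) (x - y) -` ball x r = ball y r"
    by (auto simp: dist_norm algebra_simps)
  finally show ?thesis .
qed

text \<open>By Vitali's theorem an open set is a disjoint union of balls up to a null set, and an
  orthogonal transformation moves balls to balls of the same radius.\<close>

lemma emeasure_lborel_orthogonal_image_open:
  fixes T :: "'a::euclidean_space \<Rightarrow> 'a"
  assumes T: "orthogonal_transformation T" and "open U"
  shows "emeasure lborel (T ` U) = emeasure lborel U"
proof -
  note lin = orthogonal_transformation_linear[OF T]
  have open_T: "open (T ` V)" if "open V" for V
    using that T by (metis lin open_surjective_linear_image orthogonal_transformation_surj)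
  define K where "K = {i. 0 < snd i \<and> ball (fst i) (snd i) \<subseteq> U}"
  have "\<exists>i. i \<in> K \<and> x \<in> ball (fst i) (snd i) \<and> snd i < d" if "x \<in> U" "0 < d" for x d
  proof -
    obtain e where e: "0 < e" "ball x e \<subseteq> U"
      using \<open>open U\<close> \<open>x \<in> U\<close> openE by blast
    then have "ball x (min e (d / 2)) \<subseteq> U"
      by auto
    then show ?thesis
      using e \<open>0 < d\<close> by (intro exI[of _ "(x, min e (d / 2))"]) (auto simp: K_def min_less_iff_disj)
  qed
  then obtain C where C: "countable C" "C \<subseteq> K"
    "pairwise (\<lambda>i j. disjnt (ball (fst i) (snd i)) (ball (fst j) (snd j))) C"
    "negligible (U - (\<Union>i\<in>C. ball (fst i) (snd i)))"
    using Vitali_covering_theorem_balls[of U K fst snd] by blast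
  define W where "W = (\<Union>i\<in>C. ball (fst i) (snd i))"
  have W: "W \<subseteq> U" "open W"
    using C(2) by (auto simp: W_def K_def)
  have null: "emeasure lborel V = emeasure lborel V'"
    if "open V" "open V'" "V' \<subseteq> V" "negligible (V - V')" for V V' :: "'a set"
  proof -
    have "V - V' \<in> null_sets lborel"
      using that by (auto simp: negligible_iff_null_sets null_sets_completion_iff)
    then have "emeasure lborel (V - (V - V')) = emeasure lborel V"
      using that by (intro emeasure_Diff_null_set) auto
    moreover have "V - (V - V') = V'"
      using that by auto
    ultimately show ?thesis
      by simp
  qed
  have disj: "disjoint_family_on (\<lambda>i. ball (fst i) (snd i)) C"
    using C(3) by (auto simp: disjoint_family_on_def pairwise_def disjnt_def)
  have T_disj: "disjoint_family_on (\<lambda>i. ball (T (fst i)) (snd i)) C"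
    unfolding disjoint_family_on_def
  proof (intro ballI impI)
    fix i j assume "i \<in> C" "j \<in> C" "i \<noteq> j"
    then have "T ` (ball (fst i) (snd i) \<inter> ball (fst j) (snd j)) = {}"
      using disj by (auto simp: disjoint_family_on_def)
    then show "ball (T (fst i)) (snd i) \<inter> ball (T (fst j)) (snd j) = {}"
      using T by (simp only: image_Int[OF orthogonal_transformation_inj[OF T]]
          image_orthogonal_transformation_ball)
  qed
  have "T ` U - T ` W = T ` (U - W)"
    using orthogonal_transformation_inj[OF T] by (simp add: image_set_diff)
  moreover have "negligible (T ` (U - W))"
    using C(4) lin unfolding W_def
    by (intro negligible_differentiable_image_negligible linear_imp_differentiable_on) auto
  ultimately have "emeasure lborel (T ` U) = emeasure lborel (T ` W)"
    using W open_T \<open>open U\<close> by (intro null) (auto intro: image_mono)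
  also have "T ` W = (\<Union>i\<in>C. ball (T (fst i)) (snd i))"
    by (simp add: W_def image_UN image_orthogonal_transformation_ball[OF T])
  also have "emeasure lborel \<dots> = (\<integral>\<^sup>+i. emeasure lborel (ball (T (fst i)) (snd i)) \<partial>count_space C)"
    by (intro emeasure_UN_countable C T_disj) auto
  also have "\<dots> = (\<integral>\<^sup>+i. emeasure lborel (ball (fst i) (snd i)) \<partial>count_space C)"
    by (intro nn_integral_cong emeasure_lborel_ball_shift)
  also have "\<dots> = emeasure lborel W"
    unfolding W_def by (intro emeasure_UN_countable[symmetric] C disj) auto
  also have "\<dots> = emeasure lborel U"
    using W \<open>open U\<close> C(4) by (intro null[symmetric]) (auto simp: W_def)
  finally show ?thesis .
qed

lemma borel_measurable_orthogonal:
  "orthogonal_transformation T \<Longrightarrow> T \<in> borel_measurable borel"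
  for T :: "'a::euclidean_space \<Rightarrow> 'a"
  by (intro borel_measurable_continuous_onI linear_continuous_on
      linear_conv_bounded_linear[THEN iffD1] orthogonal_transformation_linear)

lemma distr_lborel_orthogonal:
  fixes T :: "'a::euclidean_space \<Rightarrow> 'a"
  assumes T: "orthogonal_transformation T"
  shows "distr lborel borel T = lborel"
proof (rule lborel_eqI[symmetric])
  fix l u :: 'a
  assume lu: "\<And>b. b \<in> Basis \<Longrightarrow> l \<bullet> b \<le> u \<bullet> b"
  have "emeasure (distr lborel borel T) (box l u) = emeasure lborel (T -` box l u)"
    using borel_measurable_orthogonal[OF T] by (subst emeasure_distr) auto
  also have "T -` box l u = inv T ` box l u"
    using orthogonal_transformation_bij[OF T] by (simp add: bij_vimage_eq_inv_image)
  also have "emeasure lborel \<dots> = emeasure lborel (box l u)"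
    using orthogonal_transformation_inv[OF T] by (rule emeasure_lborel_orthogonal_image_open) auto
  finally show "emeasure (distr lborel borel T) (box l u) = (\<Prod>b\<in>Basis. (u - l) \<bullet> b)"
    using lu by simp
qed simp

lemma measurable_sphere_orthogonal:
  fixes T :: "'a::euclidean_space \<Rightarrow> 'a"
  assumes T: "orthogonal_transformation T"
  shows "T \<in> measurable sphere_measure sphere_measure"
proof -
  have "T \<in> measurable (restrict_space borel (sphere 0 1)) (restrict_space borel (sphere 0 1))"
    using borel_measurable_orthogonal[OF T] orthogonal_transformation_norm[OF T]
    by (intro measurable_restrict_space3) auto
  then show ?thesis
    by (simp cong: measurable_cong_sets)
qed

text \<open>The measure of a set on the sphere is the normalized volume of the cone over it, and
  forming cones commutes with linear isometries.\<close>

lemma distr_sphere_orthogonal: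
  fixes T :: "'a::euclidean_space \<Rightarrow> 'a"
  assumes T: "orthogonal_transformation T"
  shows "distr sphere_measure sphere_measure T = sphere_measure"
proof (rule measure_eqI)
  fix A assume "A \<in> sets (distr sphere_measure sphere_measure T)"
  then have A: "A \<in> sets borel" "A \<subseteq> sphere 0 1" and A': "A \<in> sets sphere_measure"
    by (auto simp: sets_restrict_space_iff)
  note lin = orthogonal_transformation_linear[OF T]
  let ?E = "\<lambda>A. {r *\<^sub>R x | r x. 0 < r \<and> r \<le> 1 \<and> x \<in> (A :: 'a set)}"
  have TA: "T -` A \<in> sets borel" "T -` A \<subseteq> sphere 0 1"
    using measurable_sets[OF borel_measurable_orthogonal[OF T] A(1)] A(2)
      orthogonal_transformation_norm[OF T] by auto
  have E: "?E A \<in> sets borel"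
  proof -
    have "?E A = cball 0 1 \<inter> sgn -` A"
    proof (intro set_eqI iffI)
      fix y assume y: "y \<in> cball 0 1 \<inter> sgn -` A"
      then have "y \<noteq> 0"
        using A(2) by auto
      then have "y = norm y *\<^sub>R sgn y" "0 < norm y"
        by (simp_all add: sgn_div_norm)
      then show "y \<in> ?E A"
        using y by (intro CollectI exI[of _ "norm y"] exI[of _ "sgn y"]) auto
    next
      fix y assume "y \<in> ?E A"
      then obtain r x where rx: "y = r *\<^sub>R x" "0 < r" "r \<le> 1" "x \<in> A"
        by auto
      then have "norm x = 1"
        using A(2) by auto
      then show "y \<in> cball 0 1 \<inter> sgn -` A"
        using rx by (simp add: sgn_div_norm)
    qed
    then show ?thesis
      using measurable_sets[OF sgn_measurable A(1)] by auto
  qed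
  have "emeasure (distr sphere_measure sphere_measure T) A
      = emeasure sphere_measure (T -` A \<inter> sphere 0 1)"
    using measurable_sphere_orthogonal[OF T] A' by (subst emeasure_distr) auto
  also have "T -` A \<inter> sphere 0 1 = T -` A"
    using TA by auto
  also have "emeasure sphere_measure \<dots> = emeasure lborel (?E (T -` A)) / emeasure lborel (cball (0::'a) 1)"
    using TA by (rule emeasure_sphere_measure)
  also have "?E (T -` A) = T -` ?E A"
  proof (intro set_eqI iffI)
    fix y assume "y \<in> T -` ?E A"
    then obtain r x where r: "T y = r *\<^sub>R x" "0 < r" "r \<le> 1" "x \<in> A"
      by auto
    then have "T (y /\<^sub>R r) = x"
      using lin by (simp add: linear_scale)
    then show "y \<in> ?E (T -` A)"
      using r by (intro CollectI exI[of _ r] exI[of _ "y /\<^sub>R r"]) auto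
  next
    fix y assume "y \<in> ?E (T -` A)"
    then obtain r x where r: "y = r *\<^sub>R x" "0 < r" "r \<le> 1" "T x \<in> A"
      by auto
    then have "T y = r *\<^sub>R T x"
      using lin by (simp add: linear_scale)
    then show "y \<in> T -` ?E A"
      using r by auto
  qed
  also have "emeasure lborel (T -` ?E A) = emeasure (distr lborel borel T) (?E A)"
    using borel_measurable_orthogonal[OF T] E by (subst emeasure_distr) auto
  also have "\<dots> / emeasure lborel (cball (0::'a) 1) = emeasure sphere_measure A"
    using A by (simp only: distr_lborel_orthogonal[OF T] emeasure_sphere_measure)
  finally show "emeasure (distr sphere_measure sphere_measure T) A = emeasure sphere_measure A" .
qed simp

lemma borel_measurable_sphere:
  fixes f :: "'a::euclidean_space \<Rightarrow> 'b::{second_countable_topology,t2_space}"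
  assumes "continuous_on UNIV f"
  shows "f \<in> borel_measurable sphere_measure"
proof -
  have "f \<in> borel_measurable (restrict_space borel (sphere 0 1))"
    using borel_measurable_continuous_onI[OF assms] by (rule measurable_restrict_space1)
  then show ?thesis
    by (simp cong: measurable_cong_sets)
qed

lemma integrable_sphere:
  fixes f :: "'a::euclidean_space \<Rightarrow> 'b::{banach,second_countable_topology}"
  assumes "continuous_on UNIV f"
  shows "integrable sphere_measure f"
proof -
  interpret prob_space "sphere_measure :: 'a measure"
    by (rule prob_space_sphere_measure)
  have "compact (f ` sphere 0 1)"
    using assms by (intro compact_continuous_image) (auto intro: continuous_on_subset)
  then obtain B where "\<forall>x\<in>sphere 0 1. norm (f x) \<le> B"
    using compact_imp_bounded[of "f ` sphere 0 1"] by (auto simp: bounded_iff)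
  then show ?thesis
    using borel_measurable_sphere[OF assms] by (intro integrable_const_bound[of _ B]) auto
qed

lemma integral_sphere_orthogonal:
  fixes T :: "'a::euclidean_space \<Rightarrow> 'a" and f :: "'a \<Rightarrow> 'b::{banach,second_countable_topology}"
  assumes "orthogonal_transformation T" "continuous_on UNIV f"
  shows "(LINT z|sphere_measure. f (T z)) = (LINT z|sphere_measure. f z)"
  using integral_distr[OF measurable_sphere_orthogonal[OF assms(1)] borel_measurable_sphere[OF assms(2)]]
  by (simp add: distr_sphere_orthogonal[OF assms(1)])

section \<open>Moments of monomials on the sphere\<close>

definition vec_monom :: "('n::finite \<Rightarrow> nat) \<Rightarrow> complex ^ 'n \<Rightarrow> complex" where
  "vec_monom e z = (\<Prod>i\<in>UNIV. z $ i ^ e i)"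

definition sphere_moment :: "('n::finite \<Rightarrow> nat) \<Rightarrow> real" where
  "sphere_moment e = (LINT z|sphere_measure. (norm (vec_monom e z))\<^sup>2)"

lemma continuous_vec_monom [continuous_intros]: "continuous_on A (vec_monom e)"
  unfolding vec_monom_def[abs_def] by (intro continuous_intros)

lemma orthogonal_transformation_cvecI:
  fixes T :: "complex ^ 'n \<Rightarrow> complex ^ 'n"
  assumes "linear T" "\<And>z. (\<Sum>i\<in>UNIV. (norm (T z $ i))\<^sup>2) = (\<Sum>i\<in>UNIV. (norm (z $ i))\<^sup>2)"
  shows "orthogonal_transformation T"
  using assms unfolding orthogonal_transformation by (simp add: norm_vec_def L2_set_def)

text \<open>Turning a coordinate in which the exponents differ by the angle pi / (e i - e' i)
  multiplies the integrand by -1, while the integral is unchanged.\<close>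

lemma vec_monom_orthogonal:
  fixes e e' :: "'n::finite \<Rightarrow> nat"
  assumes "e \<noteq> e'"
  shows "(LINT z|sphere_measure. vec_monom e z * cnj (vec_monom e' z)) = 0"
proof -
  obtain i where i: "e i \<noteq> e' i"
    using assms by auto
  define c where "c = cis (pi / (real (e i) - real (e' i)))"
  define T :: "complex ^ 'n \<Rightarrow> complex ^ 'n"
    where "T z = (\<chi> k. (if k = i then c else 1) * z $ k)" for z
  have "orthogonal_transformation T"
  proof (rule orthogonal_transformation_cvecI)
    show "linear T"
      by (rule linearI) (auto simp: T_def vec_eq_iff algebra_simps)
    show "(\<Sum>k\<in>UNIV. (norm (T z $ k))\<^sup>2) = (\<Sum>k\<in>UNIV. (norm (z $ k))\<^sup>2)" for z
      by (intro sum.cong) (auto simp: T_def norm_mult c_def)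
  qed
  have vT: "vec_monom f (T z) = c ^ f i * vec_monom f z" for f z
  proof -
    have "vec_monom f (T z) = (\<Prod>k\<in>UNIV. (if k = i then c ^ f k else 1) * z $ k ^ f k)"
      unfolding vec_monom_def T_def by (intro prod.cong) (auto simp: power_mult_distrib)
    then show ?thesis
      by (simp add: prod.distrib vec_monom_def)
  qed
  have "c ^ e i * cnj c ^ e' i = cis (e i * (pi / (real (e i) - real (e' i)))
      + e' i * (- (pi / (real (e i) - real (e' i)))))"
    unfolding c_def cis_cnj Complex.DeMoivre cis_mult by simp
  also have "e i * (pi / (real (e i) - real (e' i))) + e' i * (- (pi / (real (e i) - real (e' i)))) = pi"
    using i by (simp add: divide_simps) (simp add: algebra_simps)
  finally have c: "c ^ e i * cnj c ^ e' i = - 1"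
    by simp
  let ?I = "LINT z|sphere_measure. vec_monom e z * cnj (vec_monom e' z)"
  have "?I = (LINT z|sphere_measure. vec_monom e (T z) * cnj (vec_monom e' (T z)))"
    by (rule integral_sphere_orthogonal[symmetric]) (fact, intro continuous_intros)
  also have "\<dots> = (LINT z|sphere_measure. (c ^ e i * cnj c ^ e' i) * (vec_monom e z * cnj (vec_monom e' z)))"
    by (simp add: vT mult_ac)
  also have "\<dots> = - ?I"
    unfolding c by simp
  finally show ?thesis
    by simp
qed

lemma vec_monom_norm:
  "(LINT z|sphere_measure. vec_monom e z * cnj (vec_monom e z)) = of_real (sphere_moment e)"
  unfolding sphere_moment_def integral_complex_of_real[symmetric]
  by (simp only: complex_norm_square)

lemma vec_monom_inner:
  "(LINT z|sphere_measure. vec_monom e z * cnj (vec_monom e' z))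
    = (if e = e' then of_real (sphere_moment e) else 0)"
  using vec_monom_norm vec_monom_orthogonal by auto

text \<open>Expanding the rotation invariant moment of \<open>(c z\<^sub>p + s z\<^sub>q)\<^sup>n\<close> by orthogonality gives an
  identity of polynomials in \<open>t = c\<^sup>2 / s\<^sup>2\<close>, whose coefficients determine the mixed moments.\<close>

lemma sphere_moment_rotate:
  fixes e :: "'n::finite \<Rightarrow> nat"
  assumes pq: "p \<noteq> q" and i: "i \<le> n"
  shows "(n choose i) * sphere_moment (e(p := i, q := n - i)) = sphere_moment (e(p := n, q := 0))"
proof -
  define E where "E j = e(p := j, q := n - j)" for j
  define X where "X j = sphere_moment (E j)" for j
  define m where "m z = (\<Prod>k\<in>UNIV - {p, q}. z $ k ^ e k)" for z :: "complex ^ 'n"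
  have split_pq: "prod f UNIV = f p * f q * prod f (UNIV - {p, q})" for f :: "'n \<Rightarrow> complex"
    using pq by (subst prod.remove[of _ p]; simp add: prod.remove[of _ q] Diff_insert2[symmetric] mult.assoc insert_commute)
  have split_pq_sum: "sum f UNIV = f p + f q + sum f (UNIV - {p, q})" for f :: "'n \<Rightarrow> real"
    using pq by (subst sum.remove[of _ p]; simp add: sum.remove[of _ q] Diff_insert2[symmetric] add.assoc insert_commute)
  have vE: "vec_monom (E j) z = z $ p ^ j * z $ q ^ (n - j) * m z" for j z
  proof -
    have "(\<Prod>k\<in>UNIV - {p, q}. z $ k ^ E j k) = m z"
      unfolding m_def by (intro prod.cong) (auto simp: E_def)
    then show ?thesis
      using pq by (simp add: vec_monom_def split_pq E_def)
  qed
  have E_inj: "E j = E k \<longleftrightarrow> j = k" for j k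
    using pq by (auto simp: E_def fun_eq_iff split: if_splits)
  have main: "(\<Sum>j\<le>n. (real (n choose j))\<^sup>2 * X j * t ^ j) = (1 + t) ^ n * X n" if t: "0 < t" for t
  proof -
    define c s where "c = sqrt (t / (1 + t))" and "s = sqrt (1 / (1 + t))"
    have cs: "c\<^sup>2 = t / (1 + t)" "s\<^sup>2 = 1 / (1 + t)" "c\<^sup>2 + s\<^sup>2 = 1"
      using t by (auto simp: c_def s_def simp flip: add_divide_distrib)
    define T :: "complex ^ 'n \<Rightarrow> complex ^ 'n" where
      "T z = (\<chi> k. if k = p then c * z $ p + s * z $ q else if k = q then - s * z $ p + c * z $ q else z $ k)" for z
    have T: "orthogonal_transformation T"
    proof (rule orthogonal_transformation_cvecI)
      show "linear T"
        by (rule linearI) (auto simp: T_def vec_eq_iff algebra_simps)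
      fix z
      have "(norm (c * x + s * y))\<^sup>2 + (norm (- s * x + c * y))\<^sup>2
          = (c\<^sup>2 + s\<^sup>2) * ((norm x)\<^sup>2 + (norm y)\<^sup>2)" for x y :: complex
        unfolding cmod_power2 by (simp add: power2_eq_square algebra_simps)
      moreover have "(\<Sum>k\<in>UNIV - {p, q}. (norm (T z $ k))\<^sup>2) = (\<Sum>k\<in>UNIV - {p, q}. (norm (z $ k))\<^sup>2)"
        by (intro sum.cong) (auto simp: T_def)
      ultimately show "(\<Sum>k\<in>UNIV. (norm (T z $ k))\<^sup>2) = (\<Sum>k\<in>UNIV. (norm (z $ k))\<^sup>2)"
        using pq unfolding split_pq_sum cs(3) by (simp add: T_def)
    qed
    define a where "a j = real (n choose j) * c ^ j * s ^ (n - j)" for j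
    have "vec_monom (E n) (T z) = (\<Sum>j\<le>n. of_real (a j) * vec_monom (E j) z)" for z
    proof -
      have "m (T z) = m z"
        unfolding m_def by (intro prod.cong) (auto simp: T_def)
      then have "vec_monom (E n) (T z) = (c * z $ p + s * z $ q) ^ n * m z"
        using pq by (simp add: vE) (simp add: T_def)
      then show ?thesis
        unfolding binomial_ring sum_distrib_right
        by (simp add: vE a_def power_mult_distrib mult_ac)
    qed
    then have "of_real (X n) = (LINT z|sphere_measure.
        (\<Sum>j\<le>n. of_real (a j) * vec_monom (E j) z) * cnj (\<Sum>k\<le>n. of_real (a k) * vec_monom (E k) z))"
      unfolding X_def vec_monom_norm[symmetric]
      using integral_sphere_orthogonal[OF T, of "\<lambda>z. vec_monom (E n) z * cnj (vec_monom (E n) z)"]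
      by (simp add: continuous_intros)
    also have "\<dots> = (LINT z|sphere_measure.
        (\<Sum>j\<le>n. \<Sum>k\<le>n. of_real (a j * a k) * (vec_monom (E j) z * cnj (vec_monom (E k) z))))"
      by (simp add: sum_product mult_ac)
    also have "\<dots> = (\<Sum>j\<le>n. \<Sum>k\<le>n. of_real (a j * a k) *
        (LINT z|sphere_measure. vec_monom (E j) z * cnj (vec_monom (E k) z)))"
      by (subst Bochner_Integration.integral_sum | intro sum.cong refl integrable_sphere continuous_intros | simp)+
    also have "\<dots> = (\<Sum>j\<le>n. \<Sum>k\<le>n. if k = j then of_real (a j * a j * X j) else 0)"
      by (intro sum.cong) (auto simp: vec_monom_inner E_inj X_def)
    also have "\<dots> = of_real (\<Sum>j\<le>n. (a j)\<^sup>2 * X j)"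
      by (simp add: power2_eq_square)
    finally have "X n = (\<Sum>j\<le>n. (a j)\<^sup>2 * X j)"
      by (simp only: of_real_eq_iff)
    also have "\<dots> = (\<Sum>j\<le>n. (real (n choose j))\<^sup>2 * X j * t ^ j / (1 + t) ^ n)"
    proof (intro sum.cong refl)
      fix j assume "j \<in> {..n}"
      then have n: "n = j + (n - j)"
        by simp
      have "(a j)\<^sup>2 = (real (n choose j))\<^sup>2 * ((c\<^sup>2) ^ j * (s\<^sup>2) ^ (n - j))"
        by (simp add: a_def power_mult_distrib flip: power_mult) (simp add: mult.commute)
      also have "(c\<^sup>2) ^ j * (s\<^sup>2) ^ (n - j) = t ^ j / (1 + t) ^ n"
        unfolding cs power_divide by (subst (2) n) (simp add: power_add)
      finally show "(a j)\<^sup>2 * X j = (real (n choose j))\<^sup>2 * X j * t ^ j / (1 + t) ^ n"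
        by simp
    qed
    finally show ?thesis
      using t by (simp add: field_simps flip: sum_divide_distrib)
  qed
  define C where "C j = (real (n choose j))\<^sup>2 * X j - real (n choose j) * X n" for j
  have "(\<Sum>j\<le>n. C j * t ^ j) = 0" if "0 < t" for t
  proof -
    have bin: "(1 + t) ^ n = (\<Sum>j\<le>n. real (n choose j) * t ^ j)"
      using binomial_ring[of t 1 n] by (simp add: add.commute)
    have "(\<Sum>j\<le>n. (real (n choose j))\<^sup>2 * X j * t ^ j)
        = (\<Sum>j\<le>n. real (n choose j) * X n * t ^ j)"
      using main[OF that] unfolding bin sum_distrib_right by (simp only: mult_ac)
    then show ?thesis
      by (simp add: C_def left_diff_distrib sum_subtractf)
  qed
  then have "{0<..} \<subseteq> {t. (\<Sum>j\<le>n. C j * t ^ j) = 0}"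
    by auto
  then have "infinite {t. (\<Sum>j\<le>n. C j * t ^ j) = 0}"
    using infinite_Ioi[of "0::real"] finite_subset by blast
  then have "C i = 0"
    using polyfun_finite_roots[of C n] i by blast
  then have "real (n choose i) * (real (n choose i) * X i - X n) = 0"
    by (simp add: C_def power2_eq_square algebra_simps)
  then show ?thesis
    using i by (simp add: X_def E_def)
qed

section \<open>Moments in three coordinates\<close>

definition exponents3 :: "nat \<Rightarrow> nat \<Rightarrow> nat \<Rightarrow> 3 \<Rightarrow> nat" where
  "exponents3 a b c i = (if i = 1 then a else if i = 2 then b else c)"

lemma prod_3: "prod f (UNIV :: 3 set) = f 1 * f 2 * f 3"
  for f :: "3 \<Rightarrow> 'a::comm_monoid_mult"
  unfolding UNIV_3 by (simp add: mult.assoc)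

lemma vec_monom_exponents3: "vec_monom (exponents3 a b c) z = z $ 1 ^ a * z $ 2 ^ b * z $ 3 ^ c"
  unfolding vec_monom_def prod_3 by (simp add: exponents3_def)

lemma exponents3_eq_iff:
  "exponents3 a b c = exponents3 a' b' c' \<longleftrightarrow> a = a' \<and> b = b' \<and> c = c'"
  by (simp add: fun_eq_iff forall_3 exponents3_def)

text \<open>Two applications of the planar rotation identity: one moves the joint exponent N - a of
  coordinates 2 and 3 to coordinate 2, the other moves everything to coordinate 1. So the moment
  times its trinomial coefficient is the same for all exponents of degree \<open>N\<close>.\<close>

lemma sphere_moment_exponents3:
  assumes "a + b \<le> N"
  shows "real (N choose a) * real ((N - a) choose b) * sphere_moment (exponents3 a b (N - a - b))
    = sphere_moment (exponents3 N 0 0)"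
proof -
  have "((N - a) choose b) * sphere_moment ((exponents3 a 0 0)(2 := b, 3 := N - a - b))
      = sphere_moment ((exponents3 a 0 0)(2 := N - a, 3 := 0))"
    using assms by (intro sphere_moment_rotate) auto
  moreover have "(N choose a) * sphere_moment ((exponents3 0 0 0)(1 := a, 2 := N - a))
      = sphere_moment ((exponents3 0 0 0)(1 := N, 2 := 0))"
    using assms by (intro sphere_moment_rotate) auto
  moreover have "(exponents3 a 0 0)(2 := b, 3 := N - a - b) = exponents3 a b (N - a - b)"
    "(exponents3 a 0 0)(2 := N - a, 3 := 0) = exponents3 a (N - a) 0"
    "(exponents3 0 0 0)(1 := a, 2 := N - a) = exponents3 a (N - a) 0"
    "(exponents3 0 0 0)(1 := N, 2 := 0) = exponents3 N 0 0"
    by (simp_all add: fun_eq_iff forall_3 exponents3_def)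
  ultimately show ?thesis
    by (simp add: mult.assoc)
qed

lemma trinomial:
  fixes x y w :: "'a::comm_semiring_1"
  shows "(x + y + w) ^ N = (\<Sum>a\<le>N. \<Sum>b\<le>N - a.
    of_nat (N choose a) * of_nat ((N - a) choose b) * (x ^ a * y ^ b * w ^ (N - a - b)))"
  unfolding add.assoc binomial_ring sum_distrib_left by (simp add: mult_ac)

text \<open>The N-th power of the squared norm is 1 on the sphere, and its expansion has (N + 1) *
  (N + 2) / 2 terms, all with the same integral.\<close>

lemma sphere_moment_top:
  "sphere_moment (exponents3 N 0 0) * ((real N + 1) * (real N + 2) / 2) = 1"
proof -
  interpret prob_space "sphere_measure :: (complex ^ 3) measure"
    by (rule prob_space_sphere_measure)
  let ?e = "\<lambda>a b. exponents3 a b (N - a - b)"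
  have "1 = (LINT z|(sphere_measure :: (complex ^ 3) measure). (1 :: real))"
    using prob_space by simp
  also have "\<dots> = (LINT z|sphere_measure. (\<Sum>a\<le>N. \<Sum>b\<le>N - a.
      real (N choose a) * real ((N - a) choose b) * (norm (vec_monom (?e a b) z))\<^sup>2))"
  proof (intro Bochner_Integration.integral_cong refl)
    fix z :: "complex ^ 3" assume "z \<in> space sphere_measure"
    then have "(norm z)\<^sup>2 = 1"
      by simp
    then have "(norm (z $ 1))\<^sup>2 + (norm (z $ 2))\<^sup>2 + (norm (z $ 3))\<^sup>2 = 1"
      by (simp add: norm_vec_def L2_set_def sum_3)
    then have "1 = ((norm (z $ 1))\<^sup>2 + (norm (z $ 2))\<^sup>2 + (norm (z $ 3))\<^sup>2) ^ N"
      by simp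
    then show "1 = (\<Sum>a\<le>N. \<Sum>b\<le>N - a.
        real (N choose a) * real ((N - a) choose b) * (norm (vec_monom (?e a b) z))\<^sup>2)"
      unfolding trinomial
      by (simp add: vec_monom_exponents3 norm_mult norm_power power_mult_distrib mult.commute
          flip: power_mult)
  qed
  also have "\<dots> = (\<Sum>a\<le>N. \<Sum>b\<le>N - a.
      real (N choose a) * real ((N - a) choose b) * sphere_moment (?e a b))"
    unfolding sphere_moment_def
    by (subst Bochner_Integration.integral_sum | intro sum.cong refl integrable_sphere continuous_intros | simp)+
  also have "\<dots> = (\<Sum>a\<le>N. \<Sum>b\<le>N - a. sphere_moment (exponents3 N 0 0))"
    by (intro sum.cong refl sphere_moment_exponents3)
      (simp only: atMost_iff le_diff_conv2 add.commute)
  also have "\<dots> = sphere_moment (exponents3 N 0 0) * (\<Sum>a\<le>N. real (N - a) + 1)"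
    by (simp add: sum_distrib_left mult.commute add.commute)
  also have "(\<Sum>a\<le>N. real (N - a) + 1) = (\<Sum>a\<le>N. real a + 1)"
    using sum.atLeastAtMost_rev[of "\<lambda>a. real a + 1" 0 N] unfolding atLeast0AtMost by simp
  also have "\<dots> = (real N + 1) * (real N + 2) / 2"
    by (induction N) (auto simp: field_simps)
  finally show ?thesis
    by simp
qed

section \<open>Unimodular phases on the exponent triangle\<close>

text \<open>On the row \<open>a\<close> of the triangle the two Rudin--Shapiro products \<open>r(a) r(b)\<close> and
  \<open>r(a) r(N - a - b)\<close> are blended: the first one alone would be useless where \<open>N - a - b\<close> is much
  smaller than \<open>b\<close>, and there its weight is small. As the sequences are real and the squares of the
  weights add up to 1, the blend with the factor \<open>\<i>\<close> stays unimodular.\<close>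

definition rs_phase :: "nat \<Rightarrow> nat \<Rightarrow> nat \<Rightarrow> complex" where
  "rs_phase N a b = (if a = N then 1 else of_real (rudin_shapiro a) *
     (of_real (sqrt (real (N - a - b) / real (N - a)) * rudin_shapiro b)
       + \<i> * of_real (sqrt (real b / real (N - a)) * rudin_shapiro (N - a - b))))"

lemma rudin_shapiro_sq: "rudin_shapiro n * rudin_shapiro n = 1"
  using abs_rudin_shapiro[of n] by (metis abs_mult_self_eq mult_1)

lemma norm_rs_phase:
  assumes "a + b \<le> N"
  shows "norm (rs_phase N a b) = 1"
proof (cases "a = N")
  case False
  have "(norm (of_real (sqrt (real (N - a - b) / real (N - a)) * rudin_shapiro b)
       + \<i> * of_real (sqrt (real b / real (N - a)) * rudin_shapiro (N - a - b))))\<^sup>2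
      = real (N - a - b) / real (N - a) + real b / real (N - a)"
    unfolding cmod_power2 by (simp add: power_mult_distrib power2_eq_square[of "rudin_shapiro _"] rudin_shapiro_sq)
  also have "\<dots> = 1"
    using assms False by (simp flip: add_divide_distrib)
  finally show ?thesis
    using False by (simp add: rs_phase_def norm_mult power2_eq_1_iff)
      (smt (verit) norm_ge_zero)
qed (simp add: rs_phase_def)

text \<open>The normalized monomial divided by the square root of the dimension. With this scaling
  the squared moduli at a point of the sphere form a trinomial distribution, and the character table
  may be used with entries of modulus 1.\<close>

definition weighted_monom :: "nat \<Rightarrow> nat \<Rightarrow> nat \<Rightarrow> complex ^ 3 \<Rightarrow> complex" where
  "weighted_monom N a b z = of_real (sqrt (real (N choose a) * real ((N - a) choose b)))
     * (z $ 1 ^ a * z $ 2 ^ b * z $ 3 ^ (N - a - b))"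

text \<open>The fraction is the conditional probability that the last of \<open>Suc m\<close> trials
  fails, given \<open>b\<close> successes. This is the origin of the factor sqrt (1 - q), and it
  lowers the number of trials by one.\<close>

lemma sqrt_bern_weight_right:
  assumes "b \<le> Suc m" "0 \<le> q" "q \<le> 1"
  shows "sqrt (real (Suc m - b) / real (Suc m)) * sqrt_bern (Suc m) q b = sqrt (1 - q) * sqrt_bern m q b"
proof -
  have "real (Suc m - b) / real (Suc m) * Bernstein (Suc m) b q = (1 - q) * Bernstein m b q"
  proof (cases "b = Suc m")
    case False
    then have b: "b \<le> m"
      using assms by simp
    have "(Suc m - b) * (Suc m choose b) = Suc m * (m choose b)"
      using binomial_absorb_comp[of "Suc m" b] by simp
    then have "real (Suc m - b) * real (Suc m choose b) = real (Suc m) * real (m choose b)"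
      by (metis of_nat_mult)
    then have 1: "real (Suc m - b) / real (Suc m) * real (Suc m choose b) = real (m choose b)"
      by (simp add: field_simps del: of_nat_Suc binomial_Suc_Suc)
    have "(1 - q) ^ (Suc m - b) = (1 - q) * (1 - q) ^ (m - b)"
      using b by (simp add: Suc_diff_le)
    then show ?thesis
      unfolding Bernstein_def mult.assoc[symmetric] 1 by (simp only: mult_ac)
  qed (simp add: Bernstein_def)
  then show ?thesis
    by (simp add: sqrt_bern_def flip: real_sqrt_mult)
qed

lemma sqrt_bern_reflect: "b \<le> m \<Longrightarrow> sqrt_bern m q b = sqrt_bern m (1 - q) (m - b)"
  by (simp add: sqrt_bern_def Bernstein_def binomial_symmetric[symmetric] mult_ac)

lemma sqrt_bern_weight_left:
  assumes "b \<le> Suc m" "0 \<le> q" "q \<le> 1"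
  shows "sqrt (real b / real (Suc m)) * sqrt_bern (Suc m) q b = sqrt q * sqrt_bern m (1 - q) (Suc m - b)"
  using sqrt_bern_weight_right[of "Suc m - b" m "1 - q"] sqrt_bern_reflect[of b "Suc m" q] assms
  by simp

lemma norm_1_power_diff:
  fixes u :: complex
  assumes "norm u = 1" "b \<le> n"
  shows "u ^ (n - b) = u ^ n * cnj u ^ b"
proof -
  have "u * cnj u = 1"
    using assms by (simp add: complex_norm_square[symmetric])
  then have "u ^ b * cnj u ^ b = 1"
    by (simp flip: power_mult_distrib)
  moreover have "u ^ n = u ^ (n - b) * u ^ b"
    using assms by (simp flip: power_add)
  ultimately show ?thesis
    by (simp add: mult.assoc)
qed

text \<open>The squared moduli of the coordinates define \<open>p\<close> and the conditional
  probability \<open>q\<close>, while their arguments are absorbed into unimodular arguments of the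
  polynomials. Each of the two sign patterns then yields one outer sum, at \<open>q\<close> or at
  \<open>1 - q\<close>, whence twice 10152000. The free unimodular \<open>x\<close> and
  \<open>y\<close> stand for the characters.\<close>

lemma norm_weighted_rows_le:
  assumes z: "norm z = 1" and xy: "norm x = 1" "norm y = 1" and d: "d \<le> N"
  shows "norm (\<Sum>a\<in>{c..<d}. \<Sum>b\<le>N - a. x ^ a * y ^ b * rs_phase N a b * weighted_monom N a b z)
    \<le> 20304000"
proof -
  have polar: "\<exists>u. norm u = 1 \<and> w = of_real (norm w) * u" for w :: complex
  proof (cases "w = 0")
    case False
    then show ?thesis
      by (intro exI[of _ "sgn w"]) (simp add: sgn_eq norm_divide)
  qed (auto intro: exI[of _ 1])
  obtain u1 where u1: "norm u1 = 1" "z $ 1 = of_real (norm (z $ 1)) * u1"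
    using polar by blast
  obtain u2 where u2: "norm u2 = 1" "z $ 2 = of_real (norm (z $ 2)) * u2"
    using polar by blast
  obtain u3 where u3: "norm u3 = 1" "z $ 3 = of_real (norm (z $ 3)) * u3"
    using polar by blast
  define p where "p = (norm (z $ 1))\<^sup>2"
  have psum: "p + (norm (z $ 2))\<^sup>2 + (norm (z $ 3))\<^sup>2 = 1"
    using z by (simp add: p_def norm_vec_def L2_set_def sum_3)
  then have p: "0 \<le> p" "p \<le> 1"
    unfolding p_def by (auto simp: add_nonneg_nonneg intro: order_trans[OF _ eq_refl]) (smt (verit) zero_le_power2)
  obtain q where q: "0 \<le> q" "q \<le> 1" "(norm (z $ 2))\<^sup>2 = (1 - p) * q" "(norm (z $ 3))\<^sup>2 = (1 - p) * (1 - q)"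
  proof (cases "p = 1")
    case True
    then have "(norm (z $ 2))\<^sup>2 = 0" "(norm (z $ 3))\<^sup>2 = 0"
      using psum by (smt (verit) zero_le_power2)+
    then show ?thesis
      using True by (intro that[of 0]) auto
  next
    case False
    define q where "q = (norm (z $ 2))\<^sup>2 / (1 - p)"
    have "(norm (z $ 2))\<^sup>2 = (1 - p) * q"
      using False by (simp add: q_def)
    moreover from this have "(norm (z $ 3))\<^sup>2 = (1 - p) * (1 - q)"
      using psum by (simp add: algebra_simps)
    moreover have "(norm (z $ 2))\<^sup>2 \<le> 1 - p"
      using psum zero_le_power2[of "norm (z $ 3)"] by linarith
    then have "0 \<le> q" "q \<le> 1"
      using p False by (auto simp: q_def divide_le_eq)
    ultimately show ?thesis
      using that by blast
  qed
  have monom: "weighted_monom N a b z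
      = u1 ^ a * u2 ^ b * u3 ^ (N - a - b) * of_real (sqrt_bern N p a * sqrt_bern (N - a) q b)"
    if "a \<le> N" "b \<le> N - a" for a b
  proof -
    have pw: "(1 - p) ^ (N - a) = (1 - p) ^ b * (1 - p) ^ (N - a - b)"
      using that by (simp flip: power_add)
    have norms: "norm (z $ 1) = sqrt p" "norm (z $ 2) = sqrt ((1 - p) * q)" "norm (z $ 3) = sqrt ((1 - p) * (1 - q))"
      unfolding q(3,4)[symmetric] by (simp_all add: p_def)
    have "Bernstein N a p * Bernstein (N - a) b q = real (N choose a) * real ((N - a) choose b)
        * (p ^ a * ((1 - p) * q) ^ b * ((1 - p) * (1 - q)) ^ (N - a - b))"
      unfolding Bernstein_def power_mult_distrib pw by (simp only: mult_ac)
    then have "sqrt_bern N p a * sqrt_bern (N - a) q b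
        = sqrt (real (N choose a) * real ((N - a) choose b))
          * (norm (z $ 1) ^ a * norm (z $ 2) ^ b * norm (z $ 3) ^ (N - a - b))"
      unfolding sqrt_bern_def norms by (simp only: flip: real_sqrt_mult)
        (simp only: real_sqrt_mult real_sqrt_power power_mult_distrib mult_ac)
    then have "u1 ^ a * u2 ^ b * u3 ^ (N - a - b) * of_real (sqrt_bern N p a * sqrt_bern (N - a) q b)
        = of_real (sqrt (real (N choose a) * real ((N - a) choose b)))
          * ((of_real (norm (z $ 1)) * u1) ^ a * (of_real (norm (z $ 2)) * u2) ^ b
              * (of_real (norm (z $ 3)) * u3) ^ (N - a - b))"
      by (simp only: of_real_mult of_real_power power_mult_distrib mult_ac)
    then show ?thesis
      unfolding weighted_monom_def u1(2)[symmetric] u2(2)[symmetric] u3(2)[symmetric] by simp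
  qed
  define v where "v = y * u2"
  \<comment> \<open>The inverse of a unimodular number is its conjugate, so powers with exponents b
    and n - b merge into a single b-th power of \<open>w\<close>, or of \<open>w'\<close> after
    reflecting the sum.\<close>
  define w w' where "w = v * cnj u3" and "w' = u3 * cnj v"
  have v: "norm v = 1" "norm w = 1" "norm w' = 1"
    using xy u2(1) u3(1) by (auto simp: v_def w_def w'_def norm_mult)
  define G where "G a = of_real (sqrt_bern N p a) * (of_real (sqrt (1 - q)) * rs_poly (N - 1 - a) q w)" for a
  define G' where "G' a = of_real (sqrt_bern N p a) * (of_real (sqrt (1 - (1 - q))) * rs_poly (N - 1 - a) (1 - q) w')" for a
  have row: "(\<Sum>b\<le>N - a. x ^ a * y ^ b * rs_phase N a b * weighted_monom N a b z)
      = u3 ^ N * (of_real (rudin_shapiro a) * (x * u1 * cnj u3) ^ a * G a)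
        + \<i> * v ^ N * (of_real (rudin_shapiro a) * (x * u1 * cnj v) ^ a * G' a)"
    if a: "a < N" for a
  proof -
    define m where "m = N - 1 - a"
    have m: "N - a = Suc m"
      using a by (simp add: m_def)
    let ?r = "\<lambda>n. complex_of_real (rudin_shapiro n)"
    let ?c = "?r a * (x * u1) ^ a * of_real (sqrt_bern N p a)"
    have "(\<Sum>b\<le>N - a. x ^ a * y ^ b * rs_phase N a b * weighted_monom N a b z)
        = (\<Sum>b\<le>Suc m. ?c * (of_real (sqrt (1 - q)) * (?r b * (v ^ b * u3 ^ (Suc m - b)) * of_real (sqrt_bern m q b)))
            + ?c * (\<i> * of_real (sqrt q) * (?r (Suc m - b) * (v ^ b * u3 ^ (Suc m - b)) * of_real (sqrt_bern m (1 - q) (Suc m - b)))))"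
    proof (intro sum.cong)
      fix b assume "b \<in> {..Suc m}"
      then have b: "b \<le> Suc m"
        by simp
      have "rs_phase N a b * of_real (sqrt_bern (Suc m) q b)
          = ?r a * (?r b * of_real (sqrt (real (Suc m - b) / real (Suc m)) * sqrt_bern (Suc m) q b)
            + \<i> * ?r (Suc m - b) * of_real (sqrt (real b / real (Suc m)) * sqrt_bern (Suc m) q b))"
        using a unfolding rs_phase_def m of_real_mult by (simp add: algebra_simps del: of_nat_Suc)
      also have "\<dots> = ?r a * (?r b * of_real (sqrt (1 - q) * sqrt_bern m q b)
            + \<i> * ?r (Suc m - b) * of_real (sqrt q * sqrt_bern m (1 - q) (Suc m - b)))"
        unfolding sqrt_bern_weight_right[OF b q(1,2)] sqrt_bern_weight_left[OF b q(1,2)] ..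
      finally have *: "rs_phase N a b * of_real (sqrt_bern (Suc m) q b) = \<dots>" .
      have "x ^ a * y ^ b * rs_phase N a b * weighted_monom N a b z
          = ((x * u1) ^ a * of_real (sqrt_bern N p a)) * (v ^ b * u3 ^ (Suc m - b)) * (rs_phase N a b * of_real (sqrt_bern (Suc m) q b))"
        using a b monom[of a b] unfolding m by (simp add: v_def power_mult_distrib mult_ac)
      then show "x ^ a * y ^ b * rs_phase N a b * weighted_monom N a b z
          = ?c * (of_real (sqrt (1 - q)) * (?r b * (v ^ b * u3 ^ (Suc m - b)) * of_real (sqrt_bern m q b)))
            + ?c * (\<i> * of_real (sqrt q) * (?r (Suc m - b) * (v ^ b * u3 ^ (Suc m - b)) * of_real (sqrt_bern m (1 - q) (Suc m - b))))"
        unfolding * by (simp add: algebra_simps)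
    qed (simp add: m)
    also have "\<dots> = ?c * (of_real (sqrt (1 - q)) * (\<Sum>b\<le>Suc m. ?r b * (v ^ b * u3 ^ (Suc m - b)) * of_real (sqrt_bern m q b)))
        + ?c * (\<i> * of_real (sqrt q) * (\<Sum>b\<le>Suc m. ?r (Suc m - b) * (v ^ b * u3 ^ (Suc m - b)) * of_real (sqrt_bern m (1 - q) (Suc m - b))))"
      by (simp only: sum.distrib sum_distrib_left)
    \<comment> \<open>The range goes up to \<open>Suc m\<close> although \<open>rs_poly m\<close>
      stops at \<open>m\<close>: the extra summand vanishes, as \<open>m\<close> trials cannot have
      \<open>Suc m\<close> successes.\<close>
    also have "(\<Sum>b\<le>Suc m. ?r b * (v ^ b * u3 ^ (Suc m - b)) * of_real (sqrt_bern m q b))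
        = u3 ^ Suc m * rs_poly m q w"
    proof -
      have "?r b * (v ^ b * u3 ^ (Suc m - b)) * of_real (sqrt_bern m q b)
          = u3 ^ Suc m * (?r b * w ^ b * of_real (sqrt_bern m q b))" if "b \<le> Suc m" for b
        using norm_1_power_diff[OF u3(1) that] by (simp add: w_def power_mult_distrib mult_ac)
      then have "(\<Sum>b\<le>Suc m. ?r b * (v ^ b * u3 ^ (Suc m - b)) * of_real (sqrt_bern m q b))
          = (\<Sum>b\<le>Suc m. u3 ^ Suc m * (?r b * w ^ b * of_real (sqrt_bern m q b)))"
        by (intro sum.cong) auto
      then show ?thesis
        by (simp add: rs_poly_def sum_distrib_left sqrt_bern_eq_0 del: power_Suc)
    qed
    also have "(\<Sum>b\<le>Suc m. ?r (Suc m - b) * (v ^ b * u3 ^ (Suc m - b)) * of_real (sqrt_bern m (1 - q) (Suc m - b)))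
        = v ^ Suc m * rs_poly m (1 - q) w'"
    proof -
      have "(\<Sum>b\<le>Suc m. ?r (Suc m - b) * (v ^ b * u3 ^ (Suc m - b)) * of_real (sqrt_bern m (1 - q) (Suc m - b)))
          = (\<Sum>b\<le>Suc m. ?r b * (v ^ (Suc m - b) * u3 ^ b) * of_real (sqrt_bern m (1 - q) b))"
        by (rule sum.reindex_bij_witness[of _ "\<lambda>b. Suc m - b" "\<lambda>b. Suc m - b"]) auto
      also have "\<dots> = (\<Sum>b\<le>Suc m. v ^ Suc m * (?r b * w' ^ b * of_real (sqrt_bern m (1 - q) b)))"
      proof (intro sum.cong refl)
        fix b assume "b \<in> {..Suc m}"
        then show "?r b * (v ^ (Suc m - b) * u3 ^ b) * of_real (sqrt_bern m (1 - q) b)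
            = v ^ Suc m * (?r b * w' ^ b * of_real (sqrt_bern m (1 - q) b))"
          using norm_1_power_diff[OF v(1), of b "Suc m"] by (simp add: w'_def power_mult_distrib mult_ac)
      qed
      finally show ?thesis
        by (simp add: rs_poly_def sum_distrib_left sqrt_bern_eq_0 del: power_Suc)
    qed
    also have "u3 ^ Suc m = u3 ^ N * cnj u3 ^ a"
      using norm_1_power_diff[OF u3(1), of a N] a by (simp only: m[symmetric])
    also have "v ^ Suc m = v ^ N * cnj v ^ a"
      using norm_1_power_diff[OF v(1), of a N] a by (simp only: m[symmetric])
    finally show ?thesis
      unfolding G_def G'_def m_def[symmetric] by (simp add: power_mult_distrib mult_ac)
  qed
  have rows: "(\<Sum>a\<in>{c..<d}. \<Sum>b\<le>N - a. x ^ a * y ^ b * rs_phase N a b * weighted_monom N a b z)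
      = u3 ^ N * (\<Sum>a\<in>{c..<d}. of_real (rudin_shapiro a) * (x * u1 * cnj u3) ^ a * G a)
        + \<i> * v ^ N * (\<Sum>a\<in>{c..<d}. of_real (rudin_shapiro a) * (x * u1 * cnj v) ^ a * G' a)"
    unfolding sum_distrib_left sum.distrib[symmetric] using d by (intro sum.cong row) auto
  have "norm (\<Sum>a\<in>{c..<d}. \<Sum>b\<le>N - a. x ^ a * y ^ b * rs_phase N a b * weighted_monom N a b z)
      \<le> norm (\<Sum>a\<in>{c..<d}. of_real (rudin_shapiro a) * (x * u1 * cnj u3) ^ a * G a)
      + norm (\<Sum>a\<in>{c..<d}. of_real (rudin_shapiro a) * (x * u1 * cnj v) ^ a * G' a)"
    unfolding rows by (rule order_trans[OF norm_triangle_ineq]) (simp add: norm_mult norm_power u3(1) v(1))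
  also have "\<dots> \<le> 10152000 + 10152000"
  proof (rule add_mono)
    have "norm (x * u1 * cnj u3) = 1" "norm (x * u1 * cnj v) = 1" "0 \<le> 1 - q" "1 - q \<le> 1"
      using xy(1) u1(1) u3(1) v(1) q(1,2) by (simp_all add: norm_mult)
    note facts = this
    show "norm (\<Sum>a\<in>{c..<d}. of_real (rudin_shapiro a) * (x * u1 * cnj u3) ^ a * G a) \<le> 10152000"
      unfolding G_def by (rule norm_rs_row_sum_le[OF facts(1) v(2) p q(1,2) d])
    show "norm (\<Sum>a\<in>{c..<d}. of_real (rudin_shapiro a) * (x * u1 * cnj v) ^ a * G' a) \<le> 10152000"
      unfolding G'_def by (rule norm_rs_row_sum_le[OF facts(2) v(3) p facts(3,4) d])
  qed
  finally show ?thesis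
    by simp
qed

section \<open>The flat orthonormal basis\<close>

definition unity_root :: "nat \<Rightarrow> nat \<Rightarrow> complex" where
  "unity_root n k = cis (2 * pi * real k / real n)"

lemma norm_unity_root [simp]: "norm (unity_root n k) = 1"
  by (simp add: unity_root_def)

lemma unity_root_power_swap: "unity_root n k ^ a = unity_root n a ^ k"
  unfolding unity_root_def Complex.DeMoivre by (simp add: mult_ac)

lemma unity_root_orthogonal:
  assumes "k < n" "l < n"
  shows "(\<Sum>a<n. unity_root n k ^ a * cnj (unity_root n l ^ a)) = (if k = l then of_nat n else 0)"
proof -
  have n: "0 < n"
    using assms by simp
  define z where "z = unity_root n k * cnj (unity_root n l)"
  have bij: "bij_betw (\<lambda>k. unity_root n k) {..<n} {z. z ^ n = 1}"
    unfolding unity_root_def using Complex.bij_betw_roots_unity[OF n] .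
  have "unity_root n k ^ n = 1" "unity_root n l ^ n = 1"
    using bij assms by (auto simp: bij_betw_def)
  then have zn: "z ^ n = 1"
    by (simp add: z_def power_mult_distrib flip: complex_cnj_power)
  have unit: "unity_root n l * cnj (unity_root n l) = 1"
    by (simp add: complex_norm_square[symmetric])
  have z1: "z = 1 \<longleftrightarrow> k = l"
  proof
    assume "z = 1"
    then have "unity_root n k * (unity_root n l * cnj (unity_root n l)) = unity_root n l"
      by (simp add: z_def mult_ac)
    then have "unity_root n k = unity_root n l"
      by (simp add: unit)
    then show "k = l"
      using bij assms by (auto simp: bij_betw_def inj_on_def)
  qed (use unit in \<open>simp add: z_def\<close>)
  have "(\<Sum>a<n. unity_root n k ^ a * cnj (unity_root n l ^ a)) = (\<Sum>a<n. z ^ a)"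
    by (simp add: z_def power_mult_distrib)
  also have "\<dots> = (if k = l then of_nat n else 0)"
    using zn z1 geometric_sum[of z n] by auto
  finally show ?thesis .
qed

definition rect_char :: "nat \<Rightarrow> nat \<Rightarrow> nat \<times> nat \<Rightarrow> nat \<times> nat \<Rightarrow> complex" where
  "rect_char A B \<kappa> x = unity_root A (fst \<kappa>) ^ fst x * unity_root B (snd \<kappa>) ^ snd x"

text \<open>The character table is symmetric, so orthogonality of its rows is also orthogonality of
  its columns.\<close>

lemma rect_char_swap: "rect_char A B \<kappa> x = rect_char A B x \<kappa>"
  unfolding rect_char_def by (metis unity_root_power_swap)

lemma rect_char_orthogonal:
  assumes "\<kappa> \<in> {..<A} \<times> {..<B}" "\<mu> \<in> {..<A} \<times> {..<B}"
  shows "(\<Sum>x\<in>{..<A} \<times> {..<B}. rect_char A B \<kappa> x * cnj (rect_char A B \<mu> x))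
    = (if \<kappa> = \<mu> then of_nat (A * B) else 0)"
proof -
  obtain k l k' l' where kl: "\<kappa> = (k, l)" "\<mu> = (k', l')"
    by (metis surj_pair)
  have "(\<Sum>x\<in>{..<A} \<times> {..<B}. rect_char A B \<kappa> x * cnj (rect_char A B \<mu> x))
      = (\<Sum>a<A. \<Sum>b<B. (unity_root A k ^ a * cnj (unity_root A k' ^ a))
          * (unity_root B l ^ b * cnj (unity_root B l' ^ b)))"
    unfolding sum.cartesian_product by (intro sum.cong) (auto simp: rect_char_def kl mult_ac)
  also have "\<dots> = (\<Sum>a<A. unity_root A k ^ a * cnj (unity_root A k' ^ a))
      * (\<Sum>b<B. unity_root B l ^ b * cnj (unity_root B l' ^ b))"
    by (simp only: sum_product)
  also have "\<dots> = (if \<kappa> = \<mu> then of_nat (A * B) else 0)"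
    using assms by (auto simp: kl unity_root_orthogonal simp del: complex_cnj_power)
  finally show ?thesis .
qed

section \<open>Folding the triangle into a rectangle\<close>

definition tri_rows :: "nat \<Rightarrow> nat" where
  "tri_rows N = N div 2 + 1"

text \<open>The joint length of rows a and 2 * tri_rows N - 1 - a of the triangle, which is the same
  for all a: N + 2 for odd \<open>N\<close>, and N + 1 for even \<open>N\<close>, where row 0 is
  paired with an empty row.\<close>

definition tri_cols :: "nat \<Rightarrow> nat" where
  "tri_cols N = 2 * N + 3 - 2 * tri_rows N"

definition exponent_triangle :: "nat \<Rightarrow> (nat \<times> nat) set" where
  "exponent_triangle N = (SIGMA a:{..N}. {..N - a})"

text \<open>The upper half of the triangle, turned by half a revolution, completes the lower half to a
  rectangle; in each row and in the row index the map is affine, so characters of the rectangle pull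
  back to characters on each half.\<close>

definition fold_triangle :: "nat \<Rightarrow> nat \<times> nat \<Rightarrow> nat \<times> nat" where
  "fold_triangle N = (\<lambda>(a, b). if a < tri_rows N then (a, b)
     else (2 * tri_rows N - 1 - a, tri_cols N - 1 - b))"

lemma fold_triangle_bij:
  "bij_betw (fold_triangle N) (exponent_triangle N) ({..<tri_rows N} \<times> {..<tri_cols N})"
proof (rule bij_betwI')
  define A B where "A = tri_rows N" and "B = tri_cols N"
  have AB: "B + 2 * A = 2 * N + 3" "2 * A \<le> N + 2" "N + 1 \<le> 2 * A"
    by (auto simp: A_def B_def tri_rows_def tri_cols_def)
  fix x y assume "x \<in> exponent_triangle N" "y \<in> exponent_triangle N"
  then show "fold_triangle N x = fold_triangle N y \<longleftrightarrow> x = y"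
    using AB by (auto simp: fold_triangle_def exponent_triangle_def A_def[symmetric] B_def[symmetric] split: if_splits)
next
  fix x assume "x \<in> exponent_triangle N"
  then show "fold_triangle N x \<in> {..<tri_rows N} \<times> {..<tri_cols N}"
    by (auto simp: fold_triangle_def exponent_triangle_def tri_rows_def tri_cols_def)
next
  fix y assume y: "y \<in> {..<tri_rows N} \<times> {..<tri_cols N}"
  obtain a b where ab: "y = (a, b)"
    by fastforce
  show "\<exists>x\<in>exponent_triangle N. y = fold_triangle N x"
  \<comment> \<open>The two constants of the half turn add up to 2 * N + 1, so it exchanges the
    regions a + b <= N and a + b > N.\<close>
  proof (cases "a + b \<le> N")
    case True
    then show ?thesis
      using y ab by (intro bexI[of _ "(a, b)"]) (auto simp: fold_triangle_def exponent_triangle_def)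
  next
    case False
    then show ?thesis
      using y ab by (intro bexI[of _ "(2 * tri_rows N - 1 - a, tri_cols N - 1 - b)"])
        (auto simp: fold_triangle_def exponent_triangle_def tri_rows_def tri_cols_def)
  qed
qed

lemma tri_rows_cols: "real (tri_rows N * tri_cols N) = (real N + 1) * (real N + 2) / 2"
proof (cases "even N")
  case True
  then obtain k where "N = 2 * k"
    by blast
  then show ?thesis
    by (simp add: tri_rows_def tri_cols_def field_simps)
next
  case False
  then obtain k where "N = 2 * k + 1"
    by (rule oddE)
  then show ?thesis
    by (simp add: tri_rows_def tri_cols_def field_simps)
qed

section \<open>The basis polynomials and their orthonormality\<close>

abbreviation frequencies :: "nat \<Rightarrow> (nat \<times> nat) set" where
  "frequencies N \<equiv> {..<tri_rows N} \<times> {..<tri_cols N}"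

definition flat_coeff :: "nat \<Rightarrow> nat \<times> nat \<Rightarrow> nat \<times> nat \<Rightarrow> complex" where
  "flat_coeff N \<kappa> x = rect_char (tri_rows N) (tri_cols N) \<kappa> (fold_triangle N x) * rs_phase N (fst x) (snd x)"

definition flat_poly :: "nat \<Rightarrow> nat \<times> nat \<Rightarrow> complex ^ 3 \<Rightarrow> complex" where
  "flat_poly N \<kappa> z = (\<Sum>x\<in>exponent_triangle N. flat_coeff N \<kappa> x * weighted_monom N (fst x) (snd x) z)"

lemma finite_exponent_triangle [simp]: "finite (exponent_triangle N)"
  by (simp add: exponent_triangle_def)

lemma rs_phase_cnj: "a + b \<le> N \<Longrightarrow> rs_phase N a b * cnj (rs_phase N a b) = 1"
  by (simp add: complex_norm_square[symmetric] norm_rs_phase)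

lemma flat_coeff_orthogonal:
  assumes "\<kappa> \<in> frequencies N" "\<mu> \<in> frequencies N"
  shows "(\<Sum>x\<in>exponent_triangle N. flat_coeff N \<kappa> x * cnj (flat_coeff N \<mu> x))
    = (if \<kappa> = \<mu> then of_nat (tri_rows N * tri_cols N) else 0)"
proof -
  let ?c = "rect_char (tri_rows N) (tri_cols N)"
  have "(\<Sum>x\<in>exponent_triangle N. flat_coeff N \<kappa> x * cnj (flat_coeff N \<mu> x))
      = (\<Sum>x\<in>exponent_triangle N. ?c \<kappa> (fold_triangle N x) * cnj (?c \<mu> (fold_triangle N x)))"
  proof (intro sum.cong refl)
    fix x assume "x \<in> exponent_triangle N"
    then have "fst x + snd x \<le> N"
      by (auto simp: exponent_triangle_def)
    then have "flat_coeff N \<kappa> x * cnj (flat_coeff N \<mu> x)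
        = ?c \<kappa> (fold_triangle N x) * cnj (?c \<mu> (fold_triangle N x))
          * (rs_phase N (fst x) (snd x) * cnj (rs_phase N (fst x) (snd x)))"
      by (simp add: flat_coeff_def mult_ac)
    then show "flat_coeff N \<kappa> x * cnj (flat_coeff N \<mu> x)
        = ?c \<kappa> (fold_triangle N x) * cnj (?c \<mu> (fold_triangle N x))"
      using rs_phase_cnj[OF \<open>fst x + snd x \<le> N\<close>] by simp
  qed
  also have "\<dots> = (\<Sum>x\<in>frequencies N. ?c \<kappa> x * cnj (?c \<mu> x))"
    by (rule sum.reindex_bij_betw[OF fold_triangle_bij])
  finally show ?thesis
    by (simp only: rect_char_orthogonal[OF assms])
qed

text \<open>Column orthogonality, from the symmetry of the character table. It inverts the
  coefficient matrix and so recovers the monomials from the basis.\<close>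

lemma flat_coeff_complete:
  assumes x: "x \<in> exponent_triangle N" and y: "y \<in> exponent_triangle N"
  shows "(\<Sum>\<kappa>\<in>frequencies N. cnj (flat_coeff N \<kappa> y) * flat_coeff N \<kappa> x)
    = (if x = y then of_nat (tri_rows N * tri_cols N) else 0)"
proof -
  let ?c = "rect_char (tri_rows N) (tri_cols N)" and ?s = "\<lambda>x. rs_phase N (fst x) (snd x)"
  have "(\<Sum>\<kappa>\<in>frequencies N. cnj (flat_coeff N \<kappa> y) * flat_coeff N \<kappa> x)
      = ?s x * cnj (?s y) * (\<Sum>\<kappa>\<in>frequencies N. ?c (fold_triangle N x) \<kappa> * cnj (?c (fold_triangle N y) \<kappa>))"
    unfolding sum_distrib_left
    by (intro sum.cong) (simp_all add: flat_coeff_def rect_char_swap[of _ _ "fold_triangle N _"] mult_ac)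
  also have "\<dots> = ?s x * cnj (?s y) * (if fold_triangle N x = fold_triangle N y then of_nat (tri_rows N * tri_cols N) else 0)"
    using fold_triangle_bij[of N] x y by (subst rect_char_orthogonal) (auto simp: bij_betw_def)
  also have "fold_triangle N x = fold_triangle N y \<longleftrightarrow> x = y"
    using fold_triangle_bij[of N] x y by (auto simp: bij_betw_def inj_on_def)
  finally show ?thesis
    using x rs_phase_cnj[of "fst x" "snd x" N] by (auto simp: exponent_triangle_def)
qed

lemma weighted_monom_eq:
  "weighted_monom N a b z
    = of_real (sqrt (real (N choose a) * real ((N - a) choose b))) * vec_monom (exponents3 a b (N - a - b)) z"
  by (simp add: weighted_monom_def vec_monom_exponents3)

lemma weighted_monom_inner:
  assumes x: "x \<in> exponent_triangle N" and y: "y \<in> exponent_triangle N"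
  shows "(LINT z|sphere_measure. weighted_monom N (fst x) (snd x) z * cnj (weighted_monom N (fst y) (snd y) z))
    = (if x = y then 1 / of_nat (tri_rows N * tri_cols N) else 0)"
proof -
  let ?w = "\<lambda>x. sqrt (real (N choose fst x) * real ((N - fst x) choose snd x))"
  let ?e = "\<lambda>x. exponents3 (fst x) (snd x) (N - fst x - snd x)"
  have eq: "?e x = ?e y \<longleftrightarrow> x = y"
    by (auto simp: exponents3_eq_iff prod_eq_iff)
  have D: "real (tri_rows N * tri_cols N) \<noteq> 0"
    unfolding tri_rows_cols by (simp add: add_eq_0_iff)
  have "(LINT z|sphere_measure. weighted_monom N (fst x) (snd x) z * cnj (weighted_monom N (fst y) (snd y) z))
      = of_real (?w x * ?w y) * (LINT z|sphere_measure. vec_monom (?e x) z * cnj (vec_monom (?e y) z))"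
    by (simp add: weighted_monom_eq mult_ac flip: integral_mult_right_zero)
  also have "\<dots> = (if x = y then of_real (?w x * ?w x * sphere_moment (?e x)) else 0)"
    unfolding vec_monom_inner eq by (cases "x = y")
      (simp_all only: refl if_True if_False of_real_mult mult_zero_right simp_thms)
  also have "?w x * ?w x * sphere_moment (?e x) = sphere_moment (exponents3 N 0 0)"
    using x sphere_moment_exponents3[of "fst x" "snd x" N] by (auto simp: exponent_triangle_def)
  also have "\<dots> = 1 / real (tri_rows N * tri_cols N)"
    using sphere_moment_top[of N] D unfolding tri_rows_cols by (simp add: field_simps)
  finally show ?thesis
    by simp
qed

lemma continuous_weighted_monom [continuous_intros]: "continuous_on A (weighted_monom N a b)"
  unfolding weighted_monom_def[abs_def] by (intro continuous_intros)

lemma continuous_flat_poly [continuous_intros]: "continuous_on A (flat_poly N \<kappa>)"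
  unfolding flat_poly_def[abs_def] by (intro continuous_intros)

text \<open>Rows of the coefficient matrix have squared length equal to the dimension, and weighted
  monomials have squared norm one over the dimension; the two cancel.\<close>

lemma flat_poly_inner:
  assumes "\<kappa> \<in> frequencies N" "\<mu> \<in> frequencies N"
  shows "sphere_inner (flat_poly N \<kappa>) (flat_poly N \<mu>) = (if \<kappa> = \<mu> then 1 else 0)"
proof -
  let ?g = "\<lambda>x. weighted_monom N (fst x) (snd x)" and ?u = "flat_coeff N"
  have D: "real (tri_rows N * tri_cols N) \<noteq> 0"
    unfolding tri_rows_cols by (simp add: add_eq_0_iff)
  have "sphere_inner (flat_poly N \<kappa>) (flat_poly N \<mu>)
      = (LINT z|sphere_measure. (\<Sum>x\<in>exponent_triangle N. \<Sum>y\<in>exponent_triangle N.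
          (?u \<kappa> x * cnj (?u \<mu> y)) * (?g x z * cnj (?g y z))))"
    unfolding sphere_inner_def flat_poly_def cnj_sum sum_product
    by (simp only: complex_cnj_mult mult_ac)
  also have "\<dots> = (\<Sum>x\<in>exponent_triangle N. \<Sum>y\<in>exponent_triangle N.
      (?u \<kappa> x * cnj (?u \<mu> y)) * (LINT z|sphere_measure. ?g x z * cnj (?g y z)))"
    by (subst Bochner_Integration.integral_sum | intro sum.cong refl integrable_sphere continuous_intros | simp)+
  also have "\<dots> = (\<Sum>x\<in>exponent_triangle N. \<Sum>y\<in>exponent_triangle N.
      if y = x then (?u \<kappa> x * cnj (?u \<mu> x)) * (1 / of_nat (tri_rows N * tri_cols N)) else 0)"
    by (intro sum.cong refl) (auto simp: weighted_monom_inner)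
  also have "\<dots> = (\<Sum>x\<in>exponent_triangle N. ?u \<kappa> x * cnj (?u \<mu> x)) * (1 / of_nat (tri_rows N * tri_cols N))"
    by (simp add: sum_divide_distrib)
  also have "\<dots> = (if \<kappa> = \<mu> then 1 else 0)"
    unfolding flat_coeff_orthogonal[OF assms] using D by (simp del: of_nat_mult)
  finally show ?thesis .
qed

lemma flat_poly_orthonormal: "sphere_orthonormal (flat_poly N ` frequencies N)"
  unfolding sphere_orthonormal_def
proof (intro ballI)
  fix f g assume "f \<in> flat_poly N ` frequencies N" "g \<in> flat_poly N ` frequencies N"
  then obtain \<kappa> \<mu> where k: "\<kappa> \<in> frequencies N" "\<mu> \<in> frequencies N" "f = flat_poly N \<kappa>" "g = flat_poly N \<mu>"
    by blast
  show "sphere_inner f g = (if f = g then 1 else 0)"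
  proof (cases "\<kappa> = \<mu>")
    case False
    then have "sphere_inner f g = 0" "sphere_inner f f = 1"
      using k flat_poly_inner by auto
    then show ?thesis
      by auto
  qed (use k flat_poly_inner in auto)
qed

lemma sum_fun_apply: "(\<Sum>i\<in>S. f i) x = (\<Sum>i\<in>S. f i x)"
  for f :: "'i \<Rightarrow> 'a \<Rightarrow> 'b::comm_monoid_add"
  by (induction S rule: infinite_finite_induct) auto

lemma orthonormal_imp_independent:
  assumes S: "finite S" "sphere_orthonormal S" "\<And>f. f \<in> S \<Longrightarrow> continuous_on UNIV f"
  shows "cfun.independent S"
proof
  assume "cfun.dependent S"
  then obtain u g where u: "g \<in> S" "u g \<noteq> 0" "(\<Sum>f\<in>S. (\<lambda>z. u f * f z)) = 0"
    using S(1) by (auto simp: cfun.dependent_finite)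
  have zero: "(\<Sum>f\<in>S. u f * f z) = 0" for z
    using fun_cong[OF u(3), of z] by (simp add: sum_fun_apply)
  have "0 = (LINT z|sphere_measure. (\<Sum>f\<in>S. u f * f z) * cnj (g z))"
    by (simp add: zero)
  also have "\<dots> = (LINT z|sphere_measure. (\<Sum>f\<in>S. u f * (f z * cnj (g z))))"
    by (simp only: sum_distrib_right mult.assoc)
  also have "\<dots> = (\<Sum>f\<in>S. u f * (LINT z|sphere_measure. f z * cnj (g z)))"
    by (subst Bochner_Integration.integral_sum | intro sum.cong refl integrable_sphere continuous_intros S u | simp)+
  also have "\<dots> = (\<Sum>f\<in>S. if f = g then u f else 0)"
    using S(2) u(1) by (intro sum.cong refl) (auto simp: sphere_orthonormal_def sphere_inner_def)
  also have "\<dots> = u g"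
    using S(1) u(1) by simp
  finally show False
    using u(2) by simp
qed

lemma flat_poly_span: "cfun.span (flat_poly N ` frequencies N) = homogeneous_polys N"
proof
  let ?m = "\<lambda>a b z. z $ 1 ^ a * z $ 2 ^ b * z $ 3 ^ (N - a - b) :: complex"
  let ?w = "\<lambda>a b. complex_of_real (sqrt (real (N choose a) * real ((N - a) choose b)))"
  have m_in: "?m a b \<in> homogeneous_polys N" if "a + b \<le> N" for a b
    unfolding homogeneous_polys_def using that by (intro cfun.span_base) auto
  have sub: "cfun.subspace (homogeneous_polys N)"
    unfolding homogeneous_polys_def by (rule cfun.subspace_span)
  show "cfun.span (flat_poly N ` frequencies N) \<subseteq> homogeneous_polys N"
  proof (rule cfun.span_minimal[OF _ sub], safe)
    fix k l
    have "flat_poly N (k, l) = (\<Sum>x\<in>exponent_triangle N. (\<lambda>z. (flat_coeff N (k, l) x * ?w (fst x) (snd x)) * ?m (fst x) (snd x) z))"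
      by (simp add: fun_eq_iff sum_fun_apply flat_poly_def weighted_monom_def mult_ac)
    also have "\<dots> \<in> homogeneous_polys N"
      by (intro cfun.subspace_sum[OF sub] cfun.subspace_scale[OF sub] m_in) (auto simp: exponent_triangle_def)
    finally show "flat_poly N (k, l) \<in> homogeneous_polys N" .
  qed
  show "homogeneous_polys N \<subseteq> cfun.span (flat_poly N ` frequencies N)"
    unfolding homogeneous_polys_def
  proof (rule cfun.span_minimal[OF _ cfun.subspace_span], safe)
    fix a b assume ab: "a + b \<le> N"
    then have T: "(a, b) \<in> exponent_triangle N"
      by (auto simp: exponent_triangle_def)
    let ?D = "complex_of_nat (tri_rows N * tri_cols N)"
    have "real (tri_rows N * tri_cols N) \<noteq> 0"
      unfolding tri_rows_cols by (simp add: add_eq_0_iff)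
    then have D: "?D \<noteq> 0"
      by (simp del: of_nat_mult)
    have w: "?w a b \<noteq> 0"
      using ab by simp
    \<comment> \<open>The coefficients are a conjugated column of the matrix, rescaled; completeness
      isolates the single monomial \<open>(a, b)\<close>.\<close>
    have "?m a b z = (\<Sum>\<kappa>\<in>frequencies N. cnj (flat_coeff N \<kappa> (a, b)) / (?D * ?w a b) * flat_poly N \<kappa> z)" for z
    proof -
      have "(\<Sum>\<kappa>\<in>frequencies N. cnj (flat_coeff N \<kappa> (a, b)) * flat_poly N \<kappa> z)
          = (\<Sum>x\<in>exponent_triangle N. (\<Sum>\<kappa>\<in>frequencies N. cnj (flat_coeff N \<kappa> (a, b)) * flat_coeff N \<kappa> x)
              * weighted_monom N (fst x) (snd x) z)"
        unfolding flat_poly_def sum_distrib_left sum_distrib_right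
        by (subst sum.swap) (simp only: mult.assoc)
      also have "\<dots> = (\<Sum>x\<in>exponent_triangle N. if x = (a, b) then ?D * weighted_monom N (fst x) (snd x) z else 0)"
        by (intro sum.cong refl) (simp only: flat_coeff_complete[OF _ T] split: if_split, simp)
      also have "\<dots> = ?D * (?w a b * ?m a b z)"
        using T by (simp add: weighted_monom_def)
      finally have "?m a b z = (\<Sum>\<kappa>\<in>frequencies N. cnj (flat_coeff N \<kappa> (a, b)) * flat_poly N \<kappa> z) / (?D * ?w a b)"
        using D w by simp
      then show ?thesis
        by (simp add: sum_divide_distrib)
    qed
    then have "?m a b = (\<Sum>\<kappa>\<in>frequencies N. (\<lambda>z. cnj (flat_coeff N \<kappa> (a, b)) / (?D * ?w a b) * flat_poly N \<kappa> z))"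
      by (simp add: fun_eq_iff sum_fun_apply)
    also have "\<dots> \<in> cfun.span (flat_poly N ` frequencies N)"
      by (intro cfun.span_sum cfun.span_scale cfun.span_base) auto
    finally show "?m a b \<in> cfun.span (flat_poly N ` frequencies N)" .
  qed
qed

text \<open>On the unfolded rows the coefficients carry a character, on the folded ones a fixed
  unimodular factor times the conjugate character, so the bound for ranges of rows applies to each
  half. Row \<open>N\<close>, which that bound leaves out, is a single term of modulus at most 1;
  hence 2 * 20304000 + 1.\<close>

lemma norm_flat_poly_sphere_le:
  assumes N: "1 \<le> N" and z: "norm z = 1"
  shows "norm (flat_poly N \<kappa> z) \<le> 40608001"
proof -
  define A B where "A = tri_rows N" and "B = tri_cols N"
  have A: "A \<le> N" "N \<le> 2 * A - 1" "0 < A" "N \<le> B - 1"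
    using N by (auto simp: A_def B_def tri_rows_def tri_cols_def)
  define x y where "x = unity_root A (fst \<kappa>)" and "y = unity_root B (snd \<kappa>)"
  have xy: "norm x = 1" "norm y = 1"
    by (auto simp: x_def y_def)
  let ?t = "\<lambda>a b. flat_coeff N \<kappa> (a, b) * weighted_monom N a b z"
  let ?S = "\<lambda>x y a. \<Sum>b\<le>N - a. x ^ a * y ^ b * rs_phase N a b * weighted_monom N a b z"
  have "flat_poly N \<kappa> z = (\<Sum>a\<le>N. \<Sum>b\<le>N - a. ?t a b)"
    unfolding flat_poly_def exponent_triangle_def by (simp add: sum.Sigma split_def)
  also have "\<dots> = (\<Sum>a\<in>{0..<A} \<union> {A..<N} \<union> {N}. \<Sum>b\<le>N - a. ?t a b)"
    using A by (intro sum.cong) auto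
  also have "\<dots> = (\<Sum>a\<in>{0..<A}. \<Sum>b\<le>N - a. ?t a b) + (\<Sum>a\<in>{A..<N}. \<Sum>b\<le>N - a. ?t a b) + ?t N 0"
    using A by (subst sum.union_disjoint; auto)+
  also have "(\<Sum>a\<in>{0..<A}. \<Sum>b\<le>N - a. ?t a b) = (\<Sum>a\<in>{0..<A}. ?S x y a)"
    by (intro sum.cong refl)
      (auto simp: flat_coeff_def fold_triangle_def rect_char_def x_def y_def A_def B_def)
  also have "(\<Sum>a\<in>{A..<N}. \<Sum>b\<le>N - a. ?t a b)
      = x ^ (2 * A - 1) * y ^ (B - 1) * (\<Sum>a\<in>{A..<N}. ?S (cnj x) (cnj y) a)"
    unfolding sum_distrib_left
  proof (intro sum.cong refl)
    fix a b assume ab: "a \<in> {A..<N}" "b \<in> {..N - a}"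
    then have "flat_coeff N \<kappa> (a, b) = x ^ (2 * A - 1 - a) * y ^ (B - 1 - b) * rs_phase N a b"
      by (auto simp: flat_coeff_def fold_triangle_def rect_char_def x_def y_def A_def B_def)
    also have "x ^ (2 * A - 1 - a) = x ^ (2 * A - 1) * cnj x ^ a"
      using ab A by (intro norm_1_power_diff xy) auto
    also have "y ^ (B - 1 - b) = y ^ (B - 1) * cnj y ^ b"
      using ab A by (intro norm_1_power_diff xy) auto
    finally show "?t a b = x ^ (2 * A - 1) * y ^ (B - 1) * (cnj x ^ a * cnj y ^ b * rs_phase N a b * weighted_monom N a b z)"
      by (simp add: mult_ac)
  qed
  finally have split: "flat_poly N \<kappa> z = (\<Sum>a\<in>{0..<A}. ?S x y a)
      + x ^ (2 * A - 1) * y ^ (B - 1) * (\<Sum>a\<in>{A..<N}. ?S (cnj x) (cnj y) a) + ?t N 0" .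
  have 1: "norm (\<Sum>a\<in>{0..<A}. ?S x y a) \<le> 20304000"
    using xy A by (intro norm_weighted_rows_le z) auto
  have 2: "norm (x ^ (2 * A - 1) * y ^ (B - 1) * (\<Sum>a\<in>{A..<N}. ?S (cnj x) (cnj y) a)) \<le> 20304000"
    using xy norm_weighted_rows_le[OF z, of "cnj x" "cnj y" N N A] by (simp add: norm_mult norm_power)
  have 3: "norm (?t N 0) \<le> 1"
  proof -
    have "norm (flat_coeff N \<kappa> (N, 0)) = 1"
      by (simp add: flat_coeff_def rect_char_def norm_mult norm_power norm_rs_phase)
    moreover have "norm (weighted_monom N N 0 z) = norm (z $ 1) ^ N"
      by (simp add: weighted_monom_def norm_mult norm_power)
    moreover have "norm (z $ 1) ^ N \<le> 1"
      using Finite_Cartesian_Product.norm_nth_le[of z 1] z by (intro power_le_one) auto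
    ultimately show ?thesis
      by (simp add: norm_mult)
  qed
  show ?thesis
    unfolding split using 1 2 3 norm_triangle_ineq[of "\<Sum>a\<in>{0..<A}. ?S x y a" "x ^ (2 * A - 1) * y ^ (B - 1) * (\<Sum>a\<in>{A..<N}. ?S (cnj x) (cnj y) a)"]
    by (intro order_trans[OF norm_triangle_ineq]) linarith
qed

lemma flat_poly_scaleR: "flat_poly N \<kappa> (t *\<^sub>R z) = of_real t ^ N * flat_poly N \<kappa> z"
proof -
  have "weighted_monom N a b (t *\<^sub>R z) = of_real t ^ N * weighted_monom N a b z" if "a + b \<le> N" for a b
  proof -
    have "of_real t ^ N = of_real t ^ a * of_real t ^ b * (of_real t ^ (N - a - b) :: complex)"
      using that by (simp flip: power_add)
    then show ?thesis
      by (simp add: weighted_monom_def scaleR_conv_of_real[where 'a = complex] power_mult_distrib mult_ac)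
  qed
  then show ?thesis
    unfolding flat_poly_def sum_distrib_left by (intro sum.cong) (auto simp: exponent_triangle_def mult_ac)
qed

lemma norm_flat_poly_le:
  assumes N: "1 \<le> N" and z: "norm z \<le> 1"
  shows "norm (flat_poly N \<kappa> z) \<le> 40608001"
proof (cases "z = 0")
  case True
  have "flat_poly N \<kappa> (0 *\<^sub>R 0) = 0"
    using N by (subst flat_poly_scaleR) simp
  then show ?thesis
    using True by simp
next
  case False
  have "norm (flat_poly N \<kappa> (norm z *\<^sub>R sgn z)) = norm z ^ N * norm (flat_poly N \<kappa> (sgn z))"
    by (subst flat_poly_scaleR) (simp add: norm_mult norm_power)
  also have "\<dots> \<le> 1 * 40608001"
    using False z N by (intro mult_mono norm_flat_poly_sphere_le power_le_one) (auto simp: norm_sgn)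
  finally show ?thesis
    using False by (simp add: sgn_div_norm)
qed

theorem proposition3:
  shows "\<exists>C::real. \<forall>N::nat. 1 \<le> N \<longrightarrow>
    (\<exists>B. cfun.independent B \<and> cfun.span B = homogeneous_polys N \<and> sphere_orthonormal B \<and>
         (\<forall>f\<in>B. \<forall>z\<in>cball 0 1. norm (f z) \<le> C))"
proof (intro exI[of _ 40608001] allI impI)
  fix N :: nat
  assume "1 \<le> N"
  then show "\<exists>B. cfun.independent B \<and> cfun.span B = homogeneous_polys N \<and> sphere_orthonormal B \<and>
      (\<forall>f\<in>B. \<forall>z\<in>cball 0 1. norm (f z) \<le> 40608001)"
    by (intro exI[of _ "flat_poly N ` frequencies N"] conjI orthonormal_imp_independent
        flat_poly_orthonormal flat_poly_span)
      (auto intro: continuous_flat_poly norm_flat_poly_le)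
qed

end
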